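(* Let $f:\mathbb{R}^{d_x}\to\mathbb{R}$ be convex and $L_f$-smooth for some $L_f>0$, let $g:\mathbb{R}^{d_x}\to\mathbb{R}$ be $L_g$-smooth and $\mu_g$-strongly convex for some $L_g\ge\mu_g>0$, let $h:\mathbb{R}^{d_y}\to\mathbb{R}\cup\{+\infty\}$ be proper, closed and convex with convex conjugate $h^*$, and let $\mathsf{K}:\mathbb{R}^{d_x}\to\mathbb{R}^{d_y}$ be linear with operator norm $\|\mathsf{K}\|$ and $\lambda_{\min}(\mathsf{K}\mathsf{K}^* )>0$. Let $(x^\star,y^\star,z^\star)$ satisfy $$0=\nabla g(x^\star)+\mathsf{K}^*y^\star+\nabla f(z^\star),\qquad 0\in\partial h^*(y^\star)-\mathsf{K}x^\star,\qquad z^\star=x^\star.$$ Then $(x^\star,y^\star,z^\star)$ is the unique triple satisfying these conditions. Moreover, let $$\eta_x=\min\left\{\frac1{\sqrt{L_f\mu_g}},\sqrt{\frac{\lambda_{\min}(\mathsf{K}\mathsf{K}^* )}{\|\mathsf{K}\|^2}}\cdot\frac1{\sqrt{(L_g+L_f)\mu_g}}\right\},\quad\eta_y=\frac1{8\|\mathsf{K}\|^2\eta_x},\quad\eta_z=\frac1{8L_f\eta_x},$$ let $(x^k,y^k,z^k)_{k\ge0}$ be generated, from an arbitrary initial point, by any one of the four algorithms ACV-I, ACV-II, APDTR-I, APDTR-II with these stepsizes, and define $$\Psi_k=\frac1{2\eta_x}\|x^k-x^\star\|^2+\frac1{2\eta_y}\|y^k-y^\star\|^2+\frac1{\eta_z}D_f(z^k;z^\star)+s_1\langle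 y^k-y^\star,\mathsf{K}(x^k-x^\star)\rangle+s_2\langle\nabla f(z^k)-\nabla f(z^\star),x^k-x^\star\rangle,$$ where $(s_1,s_2)=(-1,-1)$ for ACV-I, $(+1,-1)$ for ACV-II, $(-1,+1)$ for APDTR-I and $(+1,+1)$ for APDTR-II. Then for any $\varepsilon>0$ the number of iterations needed to achieve $\Psi_k\le\varepsilon\Psi_0$ is $$\mathcal{O}\left(\left(\sqrt{\frac{L_f+L_g}{\mu_g}}\cdot\frac{\|\mathsf{K}\|}{\sqrt{\lambda_{\min}(\mathsf{K}\mathsf{K}^* )}}+\frac{\|\mathsf{K}\|^2}{\lambda_{\min}(\mathsf{K}\mathsf{K}^* )}\right)\log\frac1\varepsilon\right),$$ i.e. there is an absolute constant $C>0$ (independent of the problem data, the dimensions, the initial point and $\varepsilon$) such that $\Psi_k\le\varepsilon\Psi_0$ for every integer $k\ge0$ that is at least $C$ times the expression inside $\mathcal{O}(\cdot)$.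
   Context: A proper closed function $\phi$ is $\mu$-strongly convex ($\mu\ge0$; $\mu=0$ means convex) if $\phi(x)\ge\phi(y)+\langle p,x-y\rangle+\frac{\mu}{2}\|x-y\|^2$ for all $x,y\in\mathrm{dom}(\phi)$ and all $p\in\partial\phi(y)$. A differentiable $\phi$ is $L$-smooth if $\nabla\phi$ is $L$-Lipschitz. $h^*(y)=\sup_u\{\langle y,u\rangle-h(u)\}$. $D_f(x;y)=f(x)-f(y)-\langle\nabla f(y),x-y\rangle$. $\mathrm{prox}_F(v)=\arg\min_w\{F(w)+\frac12\|w-v\|^2\}$. $\mathsf{K}^*$ is the adjoint of $\mathsf{K}$ and $\lambda_{\min}(\mathsf{K}\mathsf{K}^* )$ is the smallest eigenvalue of $\mathsf{K}\mathsf{K}^*$. The underlying problem is $\min_x f(x)+g(x)+h(\mathsf{K}x)$. Each algorithm starts from $x^0,z^0\in\mathbb{R}^{d_x}$, $y^0\in\mathbb{R}^{d_y}$ and, for $k=0,1,2,\dots$, performs in the order listed: ACV-I: $x^{k+1}=\mathrm{prox}_{\eta_xg}(x^k-\eta_x\mathsf{K}^*y^k-\eta_x\nabla f(z^k))$; $y^{k+1}=\mathrm{prox}_{\eta_yh^*}(y^k+\eta_y\mathsf{K}(2x^{k+1}-x^k))$; $z^{k+1}=\frac1{1+\eta_z}z^k+\frac{\eta_z}{1+\eta_z}(2x^{k+1}-x^k)$. ACV-II: $y^{k+1}=\mathrm{prox}_{\eta_yh^*}(y^k+\eta_y\mathsf{K}x^k)$; $x^{k+1}=\mathrm{prox}_{\eta_xg}(x^k-\eta_x\mathsf{K}^*(2y^{k+1}-y^k)-\eta_x\nabla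 f(z^k))$; $z^{k+1}=\frac1{1+\eta_z}z^k+\frac{\eta_z}{1+\eta_z}(2x^{k+1}-x^k)$. APDTR-I: $z^{k+1}=\frac1{1+\eta_z}z^k+\frac{\eta_z}{1+\eta_z}x^k$; $x^{k+1}=\mathrm{prox}_{\eta_xg}(x^k-\eta_x\mathsf{K}^*y^k-\eta_x(2\nabla f(z^{k+1})-\nabla f(z^k)))$; $y^{k+1}=\mathrm{prox}_{\eta_yh^*}(y^k+\eta_y\mathsf{K}(2x^{k+1}-x^k))$. APDTR-II: $y^{k+1}=\mathrm{prox}_{\eta_yh^*}(y^k+\eta_y\mathsf{K}x^k)$; $z^{k+1}=\frac1{1+\eta_z}z^k+\frac{\eta_z}{1+\eta_z}x^k$; $x^{k+1}=\mathrm{prox}_{\eta_xg}(x^k-\eta_x\mathsf{K}^*(2y^{k+1}-y^k)-\eta_x(2\nabla f(z^{k+1})-\nabla f(z^k)))$. *)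

theory Defs
  imports "HOL-Library.Extended_Real" "Jordan_Normal_Form.Char_Poly"
begin

text \<open>
  The dimensions are natural numbers rather than types, so that one and the same constant can
  serve all dimensions: the Euclidean space of dimension d is \<^term>\<open>carrier_vec d\<close>, and a linear
  map between two such spaces is given by its matrix, its adjoint by the transpose.
  Every \<open>d\<close> below is the dimension of the space on which the function at hand lives; values
  of functions outside \<^term>\<open>carrier_vec d\<close> play no role.
\<close>

type_synonym rvec = "real Matrix.vec"
type_synonym rmat = "real Matrix.mat"

definition vnorm :: "rvec \<Rightarrow> real" where
  "vnorm v = sqrt (v \<bullet> v)"

definition op_norm :: "rmat \<Rightarrow> real" where
  "op_norm A = (SUP v\<in>{v \<in> carrier_vec (dim_col A). vnorm v \<le> 1}. vnorm (A *\<^sub>v v))"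

definition lambda_min :: "rmat \<Rightarrow> real" where
  "lambda_min A = Min {c. eigenvalue A c}"

text \<open>Frechet differentiability at \<open>y\<close> with gradient \<open>p\<close>.\<close>

definition has_gradient :: "nat \<Rightarrow> (rvec \<Rightarrow> real) \<Rightarrow> rvec \<Rightarrow> rvec \<Rightarrow> bool" where
  "has_gradient d \<phi> y p \<longleftrightarrow> p \<in> carrier_vec d \<and>
     (\<forall>e>0. \<exists>\<delta>>0. \<forall>x\<in>carrier_vec d. vnorm (x - y) < \<delta> \<longrightarrow>
        \<bar>\<phi> x - \<phi> y - p \<bullet> (x - y)\<bar> \<le> e * vnorm (x - y))"

definition grad :: "nat \<Rightarrow> (rvec \<Rightarrow> real) \<Rightarrow> rvec \<Rightarrow> rvec" where
  "grad d \<phi> y = (THE p. has_gradient d \<phi> y p)"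

definition smooth_fun :: "nat \<Rightarrow> real \<Rightarrow> (rvec \<Rightarrow> real) \<Rightarrow> bool" where
  "smooth_fun d L \<phi> \<longleftrightarrow>
     (\<forall>y\<in>carrier_vec d. \<exists>p. has_gradient d \<phi> y p) \<and>
     (\<forall>x\<in>carrier_vec d. \<forall>y\<in>carrier_vec d.
        vnorm (grad d \<phi> x - grad d \<phi> y) \<le> L * vnorm (x - y))"

definition bregman :: "nat \<Rightarrow> (rvec \<Rightarrow> real) \<Rightarrow> rvec \<Rightarrow> rvec \<Rightarrow> real" where
  "bregman d \<phi> x y = \<phi> x - \<phi> y - grad d \<phi> y \<bullet> (x - y)"

definition domain_of :: "nat \<Rightarrow> (rvec \<Rightarrow> ereal) \<Rightarrow> rvec set" where
  "domain_of d \<phi> = {x \<in> carrier_vec d. \<phi> x < \<infinity>}"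

definition proper_fun :: "nat \<Rightarrow> (rvec \<Rightarrow> ereal) \<Rightarrow> bool" where
  "proper_fun d \<phi> \<longleftrightarrow> (\<forall>x\<in>carrier_vec d. \<phi> x \<noteq> -\<infinity>) \<and> domain_of d \<phi> \<noteq> {}"

text \<open>Closedness means that the epigraph is (sequentially) closed.\<close>

definition closed_fun :: "nat \<Rightarrow> (rvec \<Rightarrow> ereal) \<Rightarrow> bool" where
  "closed_fun d \<phi> \<longleftrightarrow>
     (\<forall>u t x s. (\<forall>n. u n \<in> carrier_vec d \<and> \<phi> (u n) \<le> ereal (t n)) \<and> x \<in> carrier_vec d \<and>
        (\<lambda>n. vnorm (u n - x)) \<longlonglongrightarrow> 0 \<and> t \<longlonglongrightarrow> s \<longrightarrow> \<phi> x \<le> ereal s)"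

definition convex_fun :: "nat \<Rightarrow> (rvec \<Rightarrow> ereal) \<Rightarrow> bool" where
  "convex_fun d \<phi> \<longleftrightarrow>
     (\<forall>x\<in>carrier_vec d. \<forall>y\<in>carrier_vec d. \<forall>t::real. 0 < t \<and> t < 1 \<longrightarrow>
        \<phi> (t \<cdot>\<^sub>v x + (1 - t) \<cdot>\<^sub>v y) \<le> ereal t * \<phi> x + ereal (1 - t) * \<phi> y)"

definition subdiff :: "nat \<Rightarrow> (rvec \<Rightarrow> ereal) \<Rightarrow> rvec \<Rightarrow> rvec set" where
  "subdiff d \<phi> y = {p \<in> carrier_vec d. y \<in> domain_of d \<phi> \<and>
     (\<forall>x\<in>carrier_vec d. \<phi> y + ereal (p \<bullet> (x - y)) \<le> \<phi> x)}"

text \<open>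
  Convexity is required explicitly: the subgradient inequality says nothing at points
  without subgradients, so it does not by itself imply convexity.
\<close>

definition strongly_convex_fun :: "nat \<Rightarrow> real \<Rightarrow> (rvec \<Rightarrow> ereal) \<Rightarrow> bool" where
  "strongly_convex_fun d \<mu> \<phi> \<longleftrightarrow> proper_fun d \<phi> \<and> closed_fun d \<phi> \<and> convex_fun d \<phi> \<and>
     (\<forall>x\<in>domain_of d \<phi>. \<forall>y\<in>domain_of d \<phi>. \<forall>p\<in>subdiff d \<phi> y.
        \<phi> y + ereal (p \<bullet> (x - y) + \<mu> / 2 * (vnorm (x - y))\<^sup>2) \<le> \<phi> x)"

definition conjugate_fun :: "nat \<Rightarrow> (rvec \<Rightarrow> ereal) \<Rightarrow> rvec \<Rightarrow> ereal" where
  "conjugate_fun d \<phi> y = (SUP u\<in>carrier_vec d. ereal (y \<bullet> u) - \<phi> u)"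

text \<open>
  The proximal map as a set of minimizers, which is a singleton for proper, closed, convex \<open>F\<close>.
\<close>

definition prox :: "nat \<Rightarrow> (rvec \<Rightarrow> ereal) \<Rightarrow> rvec \<Rightarrow> rvec set" where
  "prox d F v = {w \<in> carrier_vec d. \<forall>u\<in>carrier_vec d.
     F w + ereal (1 / 2 * (vnorm (w - v))\<^sup>2) \<le> F u + ereal (1 / 2 * (vnorm (u - v))\<^sup>2)}"

datatype scheme = ACV_I | ACV_II | APDTR_I | APDTR_II

fun scheme_step ::
  "scheme \<Rightarrow> nat \<Rightarrow> nat \<Rightarrow> (rvec \<Rightarrow> real) \<Rightarrow> (rvec \<Rightarrow> real) \<Rightarrow> (rvec \<Rightarrow> ereal) \<Rightarrow> rmat \<Rightarrow>
   real \<Rightarrow> real \<Rightarrow> real \<Rightarrow> rvec \<times> rvec \<times> rvec \<Rightarrow> rvec \<times> rvec \<times> rvec \<Rightarrow> bool" where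
  "scheme_step ACV_I dx dy f g h K \<eta>x \<eta>y \<eta>z (x, y, z) (x', y', z') \<longleftrightarrow>
     x' \<in> prox dx (\<lambda>w. ereal (\<eta>x * g w))
        (x - \<eta>x \<cdot>\<^sub>v (transpose_mat K *\<^sub>v y) - \<eta>x \<cdot>\<^sub>v grad dx f z) \<and>
     y' \<in> prox dy (\<lambda>w. ereal \<eta>y * conjugate_fun dy h w)
        (y + \<eta>y \<cdot>\<^sub>v (K *\<^sub>v (2 \<cdot>\<^sub>v x' - x))) \<and>
     z' = (1 / (1 + \<eta>z)) \<cdot>\<^sub>v z + (\<eta>z / (1 + \<eta>z)) \<cdot>\<^sub>v (2 \<cdot>\<^sub>v x' - x)"
| "scheme_step ACV_II dx dy f g h K \<eta>x \<eta>y \<eta>z (x, y, z) (x', y', z') \<longleftrightarrow>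
     y' \<in> prox dy (\<lambda>w. ereal \<eta>y * conjugate_fun dy h w) (y + \<eta>y \<cdot>\<^sub>v (K *\<^sub>v x)) \<and>
     x' \<in> prox dx (\<lambda>w. ereal (\<eta>x * g w))
        (x - \<eta>x \<cdot>\<^sub>v (transpose_mat K *\<^sub>v (2 \<cdot>\<^sub>v y' - y)) - \<eta>x \<cdot>\<^sub>v grad dx f z) \<and>
     z' = (1 / (1 + \<eta>z)) \<cdot>\<^sub>v z + (\<eta>z / (1 + \<eta>z)) \<cdot>\<^sub>v (2 \<cdot>\<^sub>v x' - x)"
| "scheme_step APDTR_I dx dy f g h K \<eta>x \<eta>y \<eta>z (x, y, z) (x', y', z') \<longleftrightarrow>
     z' = (1 / (1 + \<eta>z)) \<cdot>\<^sub>v z + (\<eta>z / (1 + \<eta>z)) \<cdot>\<^sub>v x \<and>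
     x' \<in> prox dx (\<lambda>w. ereal (\<eta>x * g w))
        (x - \<eta>x \<cdot>\<^sub>v (transpose_mat K *\<^sub>v y)
           - \<eta>x \<cdot>\<^sub>v (2 \<cdot>\<^sub>v grad dx f z' - grad dx f z)) \<and>
     y' \<in> prox dy (\<lambda>w. ereal \<eta>y * conjugate_fun dy h w)
        (y + \<eta>y \<cdot>\<^sub>v (K *\<^sub>v (2 \<cdot>\<^sub>v x' - x)))"
| "scheme_step APDTR_II dx dy f g h K \<eta>x \<eta>y \<eta>z (x, y, z) (x', y', z') \<longleftrightarrow>
     y' \<in> prox dy (\<lambda>w. ereal \<eta>y * conjugate_fun dy h w) (y + \<eta>y \<cdot>\<^sub>v (K *\<^sub>v x)) \<and>
     z' = (1 / (1 + \<eta>z)) \<cdot>\<^sub>v z + (\<eta>z / (1 + \<eta>z)) \<cdot>\<^sub>v x \<and>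
     x' \<in> prox dx (\<lambda>w. ereal (\<eta>x * g w))
        (x - \<eta>x \<cdot>\<^sub>v (transpose_mat K *\<^sub>v (2 \<cdot>\<^sub>v y' - y))
           - \<eta>x \<cdot>\<^sub>v (2 \<cdot>\<^sub>v grad dx f z' - grad dx f z))"

fun sign1 :: "scheme \<Rightarrow> real" where
  "sign1 ACV_I = -1"
| "sign1 ACV_II = 1"
| "sign1 APDTR_I = -1"
| "sign1 APDTR_II = 1"

fun sign2 :: "scheme \<Rightarrow> real" where
  "sign2 ACV_I = -1"
| "sign2 ACV_II = -1"
| "sign2 APDTR_I = 1"
| "sign2 APDTR_II = 1"

definition generated ::
  "scheme \<Rightarrow> nat \<Rightarrow> nat \<Rightarrow> (rvec \<Rightarrow> real) \<Rightarrow> (rvec \<Rightarrow> real) \<Rightarrow> (rvec \<Rightarrow> ereal) \<Rightarrow> rmat \<Rightarrow>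
   real \<Rightarrow> real \<Rightarrow> real \<Rightarrow> (nat \<Rightarrow> rvec) \<Rightarrow> (nat \<Rightarrow> rvec) \<Rightarrow> (nat \<Rightarrow> rvec) \<Rightarrow> bool" where
  "generated A dx dy f g h K \<eta>x \<eta>y \<eta>z x y z \<longleftrightarrow>
     x 0 \<in> carrier_vec dx \<and> y 0 \<in> carrier_vec dy \<and> z 0 \<in> carrier_vec dx \<and>
     (\<forall>k. scheme_step A dx dy f g h K \<eta>x \<eta>y \<eta>z
            (x k, y k, z k) (x (Suc k), y (Suc k), z (Suc k)))"

definition optimal_triple ::
  "nat \<Rightarrow> nat \<Rightarrow> (rvec \<Rightarrow> real) \<Rightarrow> (rvec \<Rightarrow> real) \<Rightarrow> (rvec \<Rightarrow> ereal) \<Rightarrow> rmat \<Rightarrow>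
   rvec \<Rightarrow> rvec \<Rightarrow> rvec \<Rightarrow> bool" where
  "optimal_triple dx dy f g h K xs ys zs \<longleftrightarrow>
     xs \<in> carrier_vec dx \<and> ys \<in> carrier_vec dy \<and> zs \<in> carrier_vec dx \<and>
     0\<^sub>v dx = grad dx g xs + transpose_mat K *\<^sub>v ys + grad dx f zs \<and>
     0\<^sub>v dy \<in> (\<lambda>p. p - K *\<^sub>v xs) ` subdiff dy (conjugate_fun dy h) ys \<and>
     zs = xs"

definition lyapunov ::
  "scheme \<Rightarrow> nat \<Rightarrow> (rvec \<Rightarrow> real) \<Rightarrow> rmat \<Rightarrow> real \<Rightarrow> real \<Rightarrow> real \<Rightarrow>
   rvec \<Rightarrow> rvec \<Rightarrow> rvec \<Rightarrow> rvec \<Rightarrow> rvec \<Rightarrow> rvec \<Rightarrow> real" where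
  "lyapunov A dx f K \<eta>x \<eta>y \<eta>z xs ys zs x y z =
     1 / (2 * \<eta>x) * (vnorm (x - xs))\<^sup>2 + 1 / (2 * \<eta>y) * (vnorm (y - ys))\<^sup>2
     + 1 / \<eta>z * bregman dx f z zs
     + sign1 A * ((y - ys) \<bullet> (K *\<^sub>v (x - xs)))
     + sign2 A * ((grad dx f z - grad dx f zs) \<bullet> (x - xs))"

end

theory Submission
  imports Defs
begin

text \<open>
  All four schemes are instances of one step. With \<open>X, Y, Z\<close> the errors of the new iterates,
  \<open>U = \<nabla>f(z') - \<nabla>f(z\<^sup>\<star>)\<close>, \<open>G = \<nabla>g(x') - \<nabla>g(x\<^sup>\<star>)\<close>, \<open>d\<close> the increments and \<open>s, t\<close> the signs \<open>s\<^sub>1, s\<^sub>2\<close>, the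
  step reads
  \<open>K\<^sup>*(Y + s dY) + (U + t dU) + dX/\<eta>\<^sub>x + G = 0\<close>,
  \<open>\<langle>K(X - s dX) - dY/\<eta>\<^sub>y, Y\<rangle> \<ge> 0\<close> and \<open>dZ = \<eta>\<^sub>z (X - t dX - Z)\<close>. Testing these with \<open>X\<close>, \<open>Y\<close>, \<open>U\<close>, the
  bilinear terms telescope and leave
  \<open>\<Psi>' - \<Psi> + (quadratic in dX, dY, dU) + \<langle>G, X\<rangle> + \<langle>U, Z\<rangle> \<le> 0\<close>.
  The dissipation does not contain \<open>Y\<close>, but the first equation bounds \<open>K\<^sup>*Y\<close>, hence
  \<open>\<lambda>\<^sub>m\<^sub>i\<^sub>n |Y|\<^sup>2\<close>, by quantities that do occur, so that \<open>(1 + \<theta>) \<Psi>' \<le> \<Psi>\<close> with \<open>1/\<theta>\<close> a multiple of the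
  claimed rate.
\<close>

subsection \<open>Inner products and matrix bounds\<close>

lemma dot_add_left: "dim_vec a = dim_vec c \<Longrightarrow> dim_vec b = dim_vec c \<Longrightarrow> (a + b) \<bullet> c = a \<bullet> c + b \<bullet> (c::rvec)"
  by (rule add_scalar_prod_distrib[of _ "dim_vec c"]) (auto intro: carrier_vecI)

lemma dot_add_right: "dim_vec a = dim_vec b \<Longrightarrow> dim_vec b = dim_vec c \<Longrightarrow> a \<bullet> (b + c) = a \<bullet> b + a \<bullet> (c::rvec)"
  by (rule scalar_prod_add_distrib[of _ "dim_vec c"]) (auto intro: carrier_vecI)

lemma dot_diff_left: "dim_vec a = dim_vec c \<Longrightarrow> dim_vec b = dim_vec c \<Longrightarrow> (a - b) \<bullet> c = a \<bullet> c - b \<bullet> (c::rvec)"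
  by (rule minus_scalar_prod_distrib[of _ "dim_vec c"]) (auto intro: carrier_vecI)

lemma dot_diff_right: "dim_vec a = dim_vec b \<Longrightarrow> dim_vec b = dim_vec c \<Longrightarrow> a \<bullet> (b - c) = a \<bullet> b - a \<bullet> (c::rvec)"
  by (rule scalar_prod_minus_distrib[of _ "dim_vec c"]) (auto intro: carrier_vecI)

lemma dot_comm: "dim_vec a = dim_vec b \<Longrightarrow> a \<bullet> b = b \<bullet> (a::rvec)"
  by (rule comm_scalar_prod[of _ "dim_vec b"]) (auto intro: carrier_vecI)

lemmas dot_simps = dot_add_left dot_add_right dot_diff_left dot_diff_right

lemma mat_vec_diff: "dim_vec v = dim_col A \<Longrightarrow> dim_vec w = dim_col A \<Longrightarrow> A *\<^sub>v (v - w) = A *\<^sub>v v - A *\<^sub>v (w::rvec)"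
  by (rule mult_minus_distrib_mat_vec[of _ "dim_row A" "dim_col A"]) (auto intro: carrier_vecI)

lemma mat_vec_smult: "dim_vec v = dim_col A \<Longrightarrow> A *\<^sub>v (k \<cdot>\<^sub>v v) = k \<cdot>\<^sub>v (A *\<^sub>v (v::rvec))"
  by (rule mult_mat_vec[of _ "dim_row A" "dim_col A"]) (auto intro: carrier_vecI)

lemma dot_transpose:
  "dim_vec v = dim_col A \<Longrightarrow> dim_vec w = dim_row A \<Longrightarrow> (transpose_mat A *\<^sub>v w) \<bullet> v = w \<bullet> (A *\<^sub>v (v::rvec))"
  by (rule transpose_vec_mult_scalar[of _ "dim_row A" "dim_col A"]) (auto intro: carrier_vecI)

lemma dot_self_nonneg: "0 \<le> v \<bullet> (v::rvec)"
  by (auto simp: scalar_prod_def intro: sum_nonneg)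

lemma dot_self_eq_0: "v \<bullet> v = 0 \<Longrightarrow> v = 0\<^sub>v (dim_vec (v::rvec))"
  by (intro eq_vecI) (auto simp: scalar_prod_def sum_nonneg_eq_0_iff)

lemma dot_sub_self_eq_0:
  assumes "dim_vec v = dim_vec w" "(v - w) \<bullet> (v - w) = (0::real)"
  shows "v = w"
proof (rule eq_vecI)
  fix i assume "i < dim_vec w"
  moreover have "v - w = 0\<^sub>v (dim_vec w)"
    using dot_self_eq_0[OF assms(2)] by simp
  ultimately show "v $ i = w $ i"
    by (metis eq_iff_diff_eq_0 index_minus_vec(1) index_zero_vec(1))
qed (use assms in simp)

lemma vnorm_sq: "(vnorm v)\<^sup>2 = v \<bullet> v"
  by (simp add: vnorm_def dot_self_nonneg)

lemma vnorm_nonneg [simp]: "0 \<le> vnorm v"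
  by (simp add: vnorm_def dot_self_nonneg)

lemma vnorm_smult: "vnorm (k \<cdot>\<^sub>v v) = \<bar>k\<bar> * vnorm v"
  by (simp add: vnorm_def real_sqrt_mult)

text \<open>Expanding the squared norm of \<open>(b \<bullet> b) a - (a \<bullet> b) b\<close> gives
  \<open>b \<bullet> b\<close> times the gap between the two sides; a positive factor
  \<open>b \<bullet> b\<close> can be cancelled.\<close>

lemma dot_Cauchy_Schwarz:
  assumes "dim_vec a = dim_vec (b::rvec)"
  shows "(a \<bullet> b)\<^sup>2 \<le> (a \<bullet> a) * (b \<bullet> b)"
proof (cases "b \<bullet> b = 0")
  case True
  then have "a \<bullet> b = 0"
    using dot_self_eq_0[OF True] assms by (metis carrier_vecI scalar_prod_right_zero)
  with True show ?thesis by simp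
next
  case False
  then have pos: "b \<bullet> b > 0" using dot_self_nonneg[of b] by simp
  have "0 \<le> ((b \<bullet> b) \<cdot>\<^sub>v a - (a \<bullet> b) \<cdot>\<^sub>v b) \<bullet> ((b \<bullet> b) \<cdot>\<^sub>v a - (a \<bullet> b) \<cdot>\<^sub>v b)"
    by (rule dot_self_nonneg)
  also have "\<dots> = (b \<bullet> b) * ((a \<bullet> a) * (b \<bullet> b) - (a \<bullet> b)\<^sup>2)"
    using assms dot_comm[of a b] by (simp add: dot_simps algebra_simps power2_eq_square)
  finally show ?thesis using pos by (simp add: zero_le_mult_iff)
qed

lemma dot_le_vnorm: "dim_vec a = dim_vec b \<Longrightarrow> \<bar>a \<bullet> b\<bar> \<le> vnorm a * vnorm b"
  using dot_Cauchy_Schwarz[of a b] unfolding vnorm_def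
  by (metis real_sqrt_abs real_sqrt_le_iff real_sqrt_mult)

text \<open>The squared norms of \<open>t a - b\<close> and \<open>t a + b\<close> are both
  nonnegative, which covers both signs inside the absolute value. The free weight \<open>t\<close>
  later decides how a coupling term is shared between its two factors.\<close>

lemma dot_Young:
  assumes "dim_vec a = dim_vec (b::rvec)" "t > 0"
  shows "\<bar>a \<bullet> b\<bar> \<le> t / 2 * (a \<bullet> a) + 1 / (2 * t) * (b \<bullet> b)"
proof -
  have "0 \<le> (t \<cdot>\<^sub>v a - b) \<bullet> (t \<cdot>\<^sub>v a - b)" "0 \<le> (t \<cdot>\<^sub>v a + b) \<bullet> (t \<cdot>\<^sub>v a + b)"
    by (rule dot_self_nonneg)+
  then have "2 * t * \<bar>a \<bullet> b\<bar> \<le> t\<^sup>2 * (a \<bullet> a) + b \<bullet> b"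
    using assms dot_comm[of a b] by (simp add: dot_simps algebra_simps power2_eq_square abs_if)
  then have "2 * t * \<bar>a \<bullet> b\<bar> / (2 * t) \<le> (t\<^sup>2 * (a \<bullet> a) + b \<bullet> b) / (2 * t)"
    using assms by (intro divide_right_mono) auto
  then show ?thesis using assms(2) by (simp add: field_simps power2_eq_square)
qed

text \<open>Coordinatewise, the gap is the sum of all ten squared pairwise differences. The five
  summands will be those of the primal optimality condition.\<close>

lemma dot_sum5:
  assumes "dim_vec a = n" "dim_vec b = n" "dim_vec c = n" "dim_vec d = n" "dim_vec (e::rvec) = n"
  shows "(a + b + c + d + e) \<bullet> (a + b + c + d + e) \<le> 5 * (a \<bullet> a + b \<bullet> b + c \<bullet> c + d \<bullet> d + e \<bullet> e)"
proof -
  have *: "(p+q+r+s+t)*(p+q+r+s+t) \<le> 5 * (p*p+q*q+r*r+s*s+t*t)" for p q r s t :: real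
  proof -
    have "0 \<le> (p-q)\<^sup>2+(p-r)\<^sup>2+(p-s)\<^sup>2+(p-t)\<^sup>2+(q-r)\<^sup>2+(q-s)\<^sup>2+(q-t)\<^sup>2+(r-s)\<^sup>2+(r-t)\<^sup>2+(s-t)\<^sup>2"
      by (intro add_nonneg_nonneg) auto
    then show ?thesis by (simp add: power2_eq_square algebra_simps)
  qed
  show ?thesis
    unfolding scalar_prod_def sum_distrib_left sum.distrib[symmetric]
    using assms by (auto simp flip: sum.distrib simp: sum_distrib_left intro!: sum_mono order.trans[OF *])
qed

text \<open>Cauchy-Schwarz in each row gives the squared Frobenius norm as constant; adding 1 keeps
  it positive for the zero matrix.\<close>

lemma mat_vec_bounded: "\<exists>M>0. \<forall>v. dim_vec v = dim_col A \<longrightarrow> (A *\<^sub>v v) \<bullet> (A *\<^sub>v v) \<le> M * (v \<bullet> (v::rvec))"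
proof -
  let ?M = "\<Sum>i<dim_row A. row A i \<bullet> row A i"
  have "(A *\<^sub>v v) \<bullet> (A *\<^sub>v v) \<le> (?M + 1) * (v \<bullet> v)" if v: "dim_vec v = dim_col A" for v
  proof -
    have "(A *\<^sub>v v) \<bullet> (A *\<^sub>v v) = (\<Sum>i<dim_row A. (row A i \<bullet> v)\<^sup>2)"
      unfolding scalar_prod_def[of "A *\<^sub>v v"] by (simp add: power2_eq_square atLeast0LessThan)
    also have "\<dots> \<le> (\<Sum>i<dim_row A. (row A i \<bullet> row A i) * (v \<bullet> v))"
      using v by (intro sum_mono dot_Cauchy_Schwarz) simp
    also have "\<dots> = ?M * (v \<bullet> v)" by (simp add: sum_distrib_right)
    also have "\<dots> \<le> (?M + 1) * (v \<bullet> v)"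
      using dot_self_nonneg[of v] by (simp add: distrib_right)
    finally show ?thesis .
  qed
  moreover have "?M + 1 > 0" by (smt (verit) dot_self_nonneg sum_nonneg)
  ultimately show ?thesis by blast
qed

section \<open>Operator norm of a matrix and of its transpose\<close>

text \<open>The supremum of reals defining \<open>op_norm\<close> is an upper bound of its set only
  once that set is known to be bounded; the Frobenius bound supplies this.\<close>

lemma op_norm_bdd_above:
  "bdd_above ((\<lambda>v. vnorm (A *\<^sub>v v)) ` {v \<in> carrier_vec (dim_col A). vnorm v \<le> 1})"
proof -
  obtain M where M: "M > 0" "\<And>v. dim_vec v = dim_col A \<Longrightarrow> (A *\<^sub>v v) \<bullet> (A *\<^sub>v v) \<le> M * (v \<bullet> v)"
    using mat_vec_bounded by blast
  have "vnorm (A *\<^sub>v u) \<le> sqrt M" if "dim_vec u = dim_col A" "vnorm u \<le> 1" for u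
  proof -
    have "u \<bullet> u \<le> 1" using that(2) by (simp add: vnorm_def)
    then have "M * (u \<bullet> u) \<le> M" using M(1) by simp
    with M(2)[OF that(1)] show ?thesis unfolding vnorm_def by simp
  qed
  then show ?thesis by (intro bdd_aboveI2[of _ _ "sqrt M"]) auto
qed

lemma op_norm_nonneg: "0 \<le> op_norm A"
proof -
  have "vnorm (A *\<^sub>v 0\<^sub>v (dim_col A)) \<le> op_norm A"
    unfolding op_norm_def by (rule cSUP_upper[OF _ op_norm_bdd_above]) (simp add: vnorm_def)
  then show ?thesis using vnorm_nonneg order_trans by blast
qed

lemma op_norm_bound:
  assumes "dim_vec v = dim_col A"
  shows "vnorm (A *\<^sub>v v) \<le> op_norm A * vnorm v"
proof (cases "vnorm v = 0")
  \<comment> \<open>A vector of norm zero cannot be normalised, so here the Frobenius bound shows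
    directly that its image vanishes.\<close>
  case True
  then have "v \<bullet> v = 0" by (simp add: vnorm_def)
  moreover obtain M where "\<And>v. dim_vec v = dim_col A \<Longrightarrow> (A *\<^sub>v v) \<bullet> (A *\<^sub>v v) \<le> M * (v \<bullet> v)"
    using mat_vec_bounded by blast
  ultimately have "(A *\<^sub>v v) \<bullet> (A *\<^sub>v v) = 0"
    using assms dot_self_nonneg[of "A *\<^sub>v v"] by fastforce
  then have "vnorm (A *\<^sub>v v) = 0" by (simp add: vnorm_def)
  with True show ?thesis by simp
next
  case False
  then have pos: "vnorm v > 0" using vnorm_nonneg[of v] by linarith
  have "vnorm (A *\<^sub>v ((1 / vnorm v) \<cdot>\<^sub>v v)) \<le> op_norm A"
    unfolding op_norm_def using assms pos
    by (intro cSUP_upper[OF _ op_norm_bdd_above]) (auto simp: vnorm_smult intro: carrier_vecI)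
  then show ?thesis using pos assms by (simp add: mat_vec_smult vnorm_smult field_simps)
qed

lemma op_norm_bound_sq:
  assumes "dim_vec v = dim_col A"
  shows "(A *\<^sub>v v) \<bullet> (A *\<^sub>v v) \<le> (op_norm A)\<^sup>2 * (v \<bullet> v)"
  using power_mono[OF op_norm_bound[OF assms] vnorm_nonneg, of 2]
  by (simp add: vnorm_sq power_mult_distrib)

text \<open>For \<open>v\<close> the image of \<open>w\<close> under the transpose, the square of
  \<open>vnorm v\<close> equals \<open>w \<bullet> (A *\<^sub>v v)\<close>, which is at most
  \<open>vnorm w * op_norm A * vnorm v\<close>; one factor \<open>vnorm v\<close> cancels.\<close>

lemma op_norm_transpose_bound_sq:
  assumes "dim_vec w = dim_row A"
  shows "(transpose_mat A *\<^sub>v w) \<bullet> (transpose_mat A *\<^sub>v w) \<le> (op_norm A)\<^sup>2 * (w \<bullet> w)"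
proof -
  let ?v = "transpose_mat A *\<^sub>v w"
  have "vnorm ?v * vnorm ?v = ?v \<bullet> ?v"
    using vnorm_sq[of ?v] by (simp add: power2_eq_square)
  also have "\<dots> = w \<bullet> (A *\<^sub>v ?v)"
    using assms by (simp add: dot_transpose)
  also have "\<dots> \<le> vnorm w * vnorm (A *\<^sub>v ?v)"
    using dot_le_vnorm[of w "A *\<^sub>v ?v"] assms by simp
  also have "\<dots> \<le> vnorm w * (op_norm A * vnorm ?v)"
    by (intro mult_left_mono op_norm_bound) auto
  finally have "vnorm ?v * vnorm ?v \<le> (op_norm A * vnorm w) * vnorm ?v"
    by (simp add: ac_simps)
  then have "vnorm ?v \<le> op_norm A * vnorm w"
    using vnorm_nonneg[of ?v] op_norm_nonneg[of A] vnorm_nonneg[of w]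
    by (metis mult_le_cancel_right mult_nonneg_nonneg order.order_iff_strict not_less)
  from power_mono[OF this vnorm_nonneg, of 2] show ?thesis
    by (simp add: vnorm_sq power_mult_distrib)
qed

subsection \<open>The smallest eigenvalue of a symmetric matrix\<close>

text \<open>For \<open>r > 0\<close> the inequality is the value at the minimiser
  \<open>s = q / r\<close>. For \<open>r = 0\<close> the expression is affine in \<open>s\<close>,
  and staying nonnegative forces its slope to vanish.\<close>

lemma quadratic_nonneg_discriminant:
  fixes p q r :: real
  assumes "\<And>s. 0 \<le> p - 2 * s * q + s\<^sup>2 * r" and "0 \<le> r"
  shows "q\<^sup>2 \<le> p * r"
proof (cases "r = 0")
  case True
  have "q = 0"
  proof (rule ccontr)
    assume "q \<noteq> 0"
    \<comment> \<open>At this \<open>s\<close> the affine expression takes the value -1.\<close>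
    then show False using assms(1)[of "(p + 1) / (2 * q)"] True by simp
  qed
  with True show ?thesis by simp
next
  case False
  then have r: "r > 0" using assms(2) by simp
  have "0 \<le> (p - 2 * (q / r) * q + (q / r)\<^sup>2 * r) * r"
    using assms(1)[of "q / r"] r by (intro mult_nonneg_nonneg) auto
  also have "\<dots> = p * r - q\<^sup>2" using r by (simp add: field_simps power2_eq_square)
  finally show ?thesis by simp
qed

text \<open>Cauchy-Schwarz for the semidefinite form of \<open>B\<close>, applied to
  \<open>v\<close> and \<open>B v\<close>, bounds the square of \<open>?q\<close> by the form at
  \<open>v\<close> times the form at \<open>B v\<close>. The latter is at most
  \<open>sqrt M * ?q\<close>, so one factor \<open>?q\<close> cancels. Thus a small form value
  forces \<open>B v\<close> to be small, without diagonalising \<open>B\<close>.\<close>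

lemma psd_mat_vec_le:
  fixes B :: rmat
  assumes B: "B \<in> carrier_mat n n"
    and sym: "\<And>v w. dim_vec v = n \<Longrightarrow> dim_vec w = n \<Longrightarrow> (B *\<^sub>v v) \<bullet> w = v \<bullet> (B *\<^sub>v w)"
    and psd: "\<And>v. dim_vec v = n \<Longrightarrow> 0 \<le> (B *\<^sub>v v) \<bullet> v"
  obtains M where "M > 0" "\<And>v. dim_vec v = n \<Longrightarrow> (B *\<^sub>v v) \<bullet> (B *\<^sub>v v) \<le> M * ((B *\<^sub>v v) \<bullet> v)"
proof -
  have [simp]: "dim_row B = n" "dim_col B = n" using B by auto
  obtain M where M: "M > 0" "\<And>v. dim_vec v = n \<Longrightarrow> (B *\<^sub>v v) \<bullet> (B *\<^sub>v v) \<le> M * (v \<bullet> v)"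
    using mat_vec_bounded[of B] by auto
  have "(B *\<^sub>v v) \<bullet> (B *\<^sub>v v) \<le> sqrt M * ((B *\<^sub>v v) \<bullet> v)" if v: "dim_vec v = n" for v
  proof -
    let ?w = "B *\<^sub>v v" and ?q = "(B *\<^sub>v v) \<bullet> (B *\<^sub>v v)"
    \<comment> \<open>This is the form evaluated at \<open>v - s B v\<close>; the discriminant of
      this quadratic in \<open>s\<close> yields Cauchy-Schwarz for the form.\<close>
    have "0 \<le> (B *\<^sub>v v) \<bullet> v - 2 * s * ?q + s\<^sup>2 * ((B *\<^sub>v ?w) \<bullet> ?w)" for s
    proof -
      have "0 \<le> (B *\<^sub>v (v - s \<cdot>\<^sub>v ?w)) \<bullet> (v - s \<cdot>\<^sub>v ?w)"
        using v by (intro psd) simp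
      also have "\<dots> = (B *\<^sub>v v) \<bullet> v - s * (?w \<bullet> ?w) - s * ((B *\<^sub>v ?w) \<bullet> v) + s * s * ((B *\<^sub>v ?w) \<bullet> ?w)"
        using v by (simp add: mat_vec_diff mat_vec_smult dot_simps algebra_simps)
      also have "(B *\<^sub>v ?w) \<bullet> v = ?q" using v by (simp add: sym)
      finally show ?thesis by (simp add: power2_eq_square)
    qed
    then have "?q\<^sup>2 \<le> ((B *\<^sub>v v) \<bullet> v) * ((B *\<^sub>v ?w) \<bullet> ?w)"
      using v by (intro quadratic_nonneg_discriminant) (auto intro: psd)
    moreover have le: "(B *\<^sub>v ?w) \<bullet> ?w \<le> sqrt M * ?q"
    proof -
      have "((B *\<^sub>v ?w) \<bullet> ?w)\<^sup>2 \<le> (B *\<^sub>v ?w) \<bullet> (B *\<^sub>v ?w) * ?q"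
        using v by (intro dot_Cauchy_Schwarz) simp
      also have "\<dots> \<le> M * ?q * ?q"
        using v by (intro mult_right_mono M(2) dot_self_nonneg) simp
      also have "\<dots> = (sqrt M * ?q)\<^sup>2"
        using M(1) by (simp add: power_mult_distrib power2_eq_square)
      finally show ?thesis
        by (rule power2_le_imp_le) (use M(1) in \<open>simp add: dot_self_nonneg\<close>)
    qed
    moreover note mult_left_mono[OF le psd[OF v]]
    ultimately have "?q * ?q \<le> (sqrt M * ((B *\<^sub>v v) \<bullet> v)) * ?q"
      by (simp add: power2_eq_square ac_simps)
    then show ?thesis
      using dot_self_nonneg[of "B *\<^sub>v v"] psd[OF v] M(1)
      by (cases "?q = 0") (simp_all add: mult_le_cancel_right)
  qed
  with M(1) show ?thesis by (intro that[of "sqrt M"]) auto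
qed

text \<open>With a left inverse \<open>N\<close>, \<open>v\<close> is \<open>N\<close> applied to
  \<open>B v\<close>, and \<open>N\<close> is bounded.\<close>

lemma invertible_mat_vec_lower_bound:
  fixes B :: rmat
  assumes B: "B \<in> carrier_mat n n" and "det B \<noteq> 0"
  obtains c where "c > 0" "\<And>v. dim_vec v = n \<Longrightarrow> v \<bullet> v \<le> c * ((B *\<^sub>v v) \<bullet> (B *\<^sub>v v))"
proof -
  obtain N where N: "N * B = 1\<^sub>m n" "N \<in> carrier_mat n n"
    using det_non_zero_imp_unit[OF assms, of "()"] unfolding Units_def ring_mat_def by auto
  obtain c where c: "c > 0" "\<And>v. dim_vec v = n \<Longrightarrow> (N *\<^sub>v v) \<bullet> (N *\<^sub>v v) \<le> c * (v \<bullet> v)"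
    using mat_vec_bounded[of N] N by auto
  have "v \<bullet> v \<le> c * ((B *\<^sub>v v) \<bullet> (B *\<^sub>v v))" if "dim_vec v = n" for v
  proof -
    have "N *\<^sub>v (B *\<^sub>v v) = v"
      using B N that carrier_vecI[OF that] by (simp flip: assoc_mult_mat_vec)
    with c(2)[of "B *\<^sub>v v"] B show ?thesis by simp
  qed
  with c(1) show ?thesis by (rule that)
qed

text \<open>Eigenvalues are roots of the monic, hence nonzero, characteristic polynomial. Finiteness
  is what lets the \<open>Min\<close> in \<open>lambda_min\<close> be compared with a given
  eigenvalue.\<close>

lemma finite_eigenvalues:
  assumes "(A :: rmat) \<in> carrier_mat n n"
  shows "finite {c. eigenvalue A c}"
proof -
  have "char_poly A \<noteq> 0" using degree_monic_char_poly[OF assms] by auto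
  then show ?thesis by (simp add: eigenvalue_root_char_poly[OF assms] poly_roots_finite)
qed

text \<open>
  The largest \<open>m\<close> for which \<open>A - m I\<close> is positive semidefinite is an eigenvalue: otherwise
  \<open>A - m I\<close> would be invertible, hence bounded below, and \<open>m\<close> could be increased.
\<close>

lemma lambda_min_le_Rayleigh:
  fixes A :: rmat
  assumes A: "A \<in> carrier_mat n n" and n: "n \<ge> 1"
    and sym: "\<And>v w. dim_vec v = n \<Longrightarrow> dim_vec w = n \<Longrightarrow> (A *\<^sub>v v) \<bullet> w = v \<bullet> (A *\<^sub>v w)"
    and v: "dim_vec v = n"
  shows "lambda_min A * (v \<bullet> v) \<le> (A *\<^sub>v v) \<bullet> v"
proof -
  have [simp]: "dim_row A = n" "dim_col A = n" using A by auto
  define T where "T = {t. \<forall>v. dim_vec v = n \<longrightarrow> t * (v \<bullet> v) \<le> (A *\<^sub>v v) \<bullet> v}"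
  define m where "m = Sup T"
  obtain M where M: "M > 0" "\<And>v. dim_vec v = n \<Longrightarrow> (A *\<^sub>v v) \<bullet> (A *\<^sub>v v) \<le> M * (v \<bullet> v)"
    using mat_vec_bounded[of A] by auto
  have "- (M / 2 + 1 / 2) * (v \<bullet> v) \<le> (A *\<^sub>v v) \<bullet> v" if "dim_vec v = n" for v
  proof -
    have "\<bar>(A *\<^sub>v v) \<bullet> v\<bar> \<le> 1 / 2 * ((A *\<^sub>v v) \<bullet> (A *\<^sub>v v)) + 1 / 2 * (v \<bullet> v)"
      using dot_Young[of "A *\<^sub>v v" v 1] that by simp
    then show ?thesis using M(2)[OF that] by (simp add: algebra_simps)
  qed
  then have T_ne: "T \<noteq> {}" unfolding T_def by blast
  \<comment> \<open>A single test vector of norm one bounds \<open>T\<close> from above; it exists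
    because \<open>n \<ge> 1\<close>.\<close>
  have "t \<le> (A *\<^sub>v unit_vec n 0) \<bullet> unit_vec n 0" if "t \<in> T" for t
    using that n unfolding T_def by (auto dest: spec[of _ "unit_vec n 0"])
  then have T_bdd: "bdd_above T" by (rule bdd_aboveI)
  \<comment> \<open>The supremum is attained: each Rayleigh quotient is an upper bound of
    \<open>T\<close>, hence at least \<open>m\<close>.\<close>
  have mT: "m * (v \<bullet> v) \<le> (A *\<^sub>v v) \<bullet> v" if v: "dim_vec v = n" for v
  proof (cases "v \<bullet> v = 0")
    case True
    then show ?thesis using T_ne v unfolding T_def by auto
  next
    case False
    then have pos: "v \<bullet> v > 0" using dot_self_nonneg[of v] by simp
    have "m \<le> ((A *\<^sub>v v) \<bullet> v) / (v \<bullet> v)"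
      unfolding m_def using v pos by (intro cSup_least[OF T_ne]) (auto simp: T_def field_simps)
    then show ?thesis using pos by (simp add: field_simps)
  qed
  have "eigenvalue A m"
  proof (rule ccontr)
    define B where "B = char_matrix A m"
    assume "\<not> eigenvalue A m"
    then have det: "det B \<noteq> 0" unfolding B_def by (simp add: eigenvalue_det[OF A])
    have B: "B \<in> carrier_mat n n" using A by (simp add: B_def)
    have Bv: "B *\<^sub>v v = A *\<^sub>v v - m \<cdot>\<^sub>v v" if "dim_vec v = n" for v
      unfolding B_def char_matrix_def using that
      by (intro eq_vecI) (auto simp: dot_add_left row_add)
    have dots: "(B *\<^sub>v v) \<bullet> w = (A *\<^sub>v v) \<bullet> w - m * (v \<bullet> w)" "v \<bullet> (B *\<^sub>v w) = v \<bullet> (A *\<^sub>v w) - m * (v \<bullet> w)"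
      if "dim_vec v = n" "dim_vec w = n" for v w
      using that by (simp_all add: Bv dot_simps)
    obtain M' where M': "M' > 0" "\<And>v. dim_vec v = n \<Longrightarrow> (B *\<^sub>v v) \<bullet> (B *\<^sub>v v) \<le> M' * ((B *\<^sub>v v) \<bullet> v)"
    proof (rule psd_mat_vec_le[OF B])
      show "(B *\<^sub>v v) \<bullet> w = v \<bullet> (B *\<^sub>v w)" if "dim_vec v = n" "dim_vec w = n" for v w
        using that by (simp add: dots sym)
      show "0 \<le> (B *\<^sub>v v) \<bullet> v" if "dim_vec v = n" for v
        using mT[OF that] that by (simp add: dots(1))
    qed blast
    obtain c where c: "c > 0" "\<And>v. dim_vec v = n \<Longrightarrow> v \<bullet> v \<le> c * ((B *\<^sub>v v) \<bullet> (B *\<^sub>v v))"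
      using invertible_mat_vec_lower_bound[OF B det] by blast
    \<comment> \<open>Chaining both bounds makes the form of \<open>B = A - m I\<close> at least
      \<open>1 / (c * M')\<close> times \<open>v \<bullet> v\<close>, which puts an element larger
      than \<open>m\<close> into \<open>T\<close>.\<close>
    have "(m + 1 / (c * M')) * (v \<bullet> v) \<le> (A *\<^sub>v v) \<bullet> v" if v: "dim_vec v = n" for v
    proof -
      have "v \<bullet> v \<le> c * (M' * ((B *\<^sub>v v) \<bullet> v))"
        using c(2)[OF v] mult_left_mono[OF M'(2)[OF v], of c] c(1) by linarith
      also have "\<dots> = (c * M') * ((A *\<^sub>v v) \<bullet> v - m * (v \<bullet> v))"
        using v by (simp add: dots)
      finally have "v \<bullet> v / (c * M') \<le> (A *\<^sub>v v) \<bullet> v - m * (v \<bullet> v)"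
        using c(1) M'(1) by (simp add: divide_le_eq mult.commute)
      then show ?thesis by (simp add: algebra_simps)
    qed
    then have "m + 1 / (c * M') \<in> T" by (simp add: T_def)
    then have "m + 1 / (c * M') \<le> m" unfolding m_def by (rule cSup_upper[OF _ T_bdd])
    then show False using c(1) M'(1) by (simp add: field_simps)
  qed
  then have "lambda_min A \<le> m"
    unfolding lambda_min_def by (intro Min_le finite_eigenvalues[OF A]) simp
  then have "lambda_min A * (v \<bullet> v) \<le> m * (v \<bullet> v)"
    by (intro mult_right_mono dot_self_nonneg)
  also have "\<dots> \<le> (A *\<^sub>v v) \<bullet> v" by (rule mT[OF v])
  finally show ?thesis .
qed

text \<open>The quadratic form of the Gram matrix at \<open>w\<close> is the squared norm of the
  transpose applied to \<open>w\<close>, so the Rayleigh bound applies. This is the only source of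
  control over the dual error.\<close>

lemma lambda_min_gram:
  fixes K :: rmat
  assumes K: "K \<in> carrier_mat m n" and m: "m \<ge> 1" and w: "dim_vec w = m"
  shows "lambda_min (K * transpose_mat K) * (w \<bullet> w) \<le> (transpose_mat K *\<^sub>v w) \<bullet> (transpose_mat K *\<^sub>v w)"
proof -
  have [simp]: "dim_row K = m" "dim_col K = n" using K by auto
  have eq: "(K * transpose_mat K) *\<^sub>v u = K *\<^sub>v (transpose_mat K *\<^sub>v u)" if "dim_vec u = m" for u
    using K carrier_vecI[OF that] by (intro assoc_mult_mat_vec) auto
  have gram: "(K *\<^sub>v (transpose_mat K *\<^sub>v u)) \<bullet> w = (transpose_mat K *\<^sub>v u) \<bullet> (transpose_mat K *\<^sub>v w)"
    if "dim_vec u = m" "dim_vec w = m" for u w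
  proof -
    have "(K *\<^sub>v (transpose_mat K *\<^sub>v u)) \<bullet> w = w \<bullet> (K *\<^sub>v (transpose_mat K *\<^sub>v u))"
      using that by (intro dot_comm) simp
    also have "\<dots> = (transpose_mat K *\<^sub>v w) \<bullet> (transpose_mat K *\<^sub>v u)"
      using that by (simp add: dot_transpose)
    also have "\<dots> = (transpose_mat K *\<^sub>v u) \<bullet> (transpose_mat K *\<^sub>v w)"
      by (rule dot_comm) simp
    finally show ?thesis .
  qed
  have "lambda_min (K * transpose_mat K) * (w \<bullet> w) \<le> ((K * transpose_mat K) *\<^sub>v w) \<bullet> w"
  proof (rule lambda_min_le_Rayleigh[OF _ m _ w])
    show "K * transpose_mat K \<in> carrier_mat m m" using K by simp
    fix u w :: rvec assume "dim_vec u = m" "dim_vec w = m"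
    then show "((K * transpose_mat K) *\<^sub>v u) \<bullet> w = u \<bullet> ((K * transpose_mat K) *\<^sub>v w)"
      by (simp add: eq gram dot_transpose[of "transpose_mat K *\<^sub>v w" K, symmetric])
  qed
  with w show ?thesis by (simp add: eq gram)
qed

text \<open>The lower and the upper bound for the transpose are compared at one unit vector. Hence
  the condition number of the coupling is at least 1.\<close>

lemma lambda_min_gram_le_op_norm_sq:
  fixes K :: rmat
  assumes "K \<in> carrier_mat m n" "m \<ge> 1"
  shows "lambda_min (K * transpose_mat K) \<le> (op_norm K)\<^sup>2"
proof -
  let ?e = "unit_vec m 0 :: rvec"
  have "lambda_min (K * transpose_mat K) * (?e \<bullet> ?e) \<le> (op_norm K)\<^sup>2 * (?e \<bullet> ?e)"
    using lambda_min_gram[OF assms, of ?e] op_norm_transpose_bound_sq[of ?e K] assms(1) by simp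
  then show ?thesis using assms(2) by simp
qed

subsection \<open>Gradients, proximal maps and conjugates\<close>

text \<open>Restriction to lines reduces all later first-order arguments to derivatives of one real
  variable.\<close>

lemma has_gradient_imp_DERIV_line:
  assumes "has_gradient d \<phi> (y + t \<cdot>\<^sub>v v) p" and v: "dim_vec v = d" and y: "dim_vec y = d"
  shows "DERIV (\<lambda>s. \<phi> (y + s \<cdot>\<^sub>v v)) t :> p \<bullet> v"
  unfolding DERIV_def
proof (rule LIM_I)
  fix r :: real assume "r > 0"
  \<comment> \<open>Adding 1 makes \<open>?N\<close> positive even for \<open>v = 0\<close> and
    yields the strict inequality required by the limit.\<close>
  let ?N = "vnorm v + 1" and ?y = "y + t \<cdot>\<^sub>v v"
  have N: "?N > 0" using vnorm_nonneg[of v] by linarith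
  have p: "dim_vec p = d" using assms(1) by (simp add: has_gradient_def)
  have "r / ?N > 0" using N \<open>r > 0\<close> by simp
  then obtain \<delta> where \<delta>: "\<delta> > 0"
    "\<And>x. x \<in> carrier_vec d \<Longrightarrow> vnorm (x - ?y) < \<delta> \<Longrightarrow>
       \<bar>\<phi> x - \<phi> ?y - p \<bullet> (x - ?y)\<bar> \<le> r / ?N * vnorm (x - ?y)"
    using assms(1) unfolding has_gradient_def by blast
  have "\<bar>(\<phi> (y + (t + h) \<cdot>\<^sub>v v) - \<phi> ?y) / h - p \<bullet> v\<bar> < r"
    if h: "h \<noteq> 0" "\<bar>h\<bar> < \<delta> / ?N" for h
  proof -
    have eq: "y + (t + h) \<cdot>\<^sub>v v - ?y = h \<cdot>\<^sub>v v"
      using v y by (intro eq_vecI) (auto simp: algebra_simps)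
    have "\<bar>h\<bar> * vnorm v \<le> \<bar>h\<bar> * ?N" by (intro mult_left_mono) auto
    also have "\<dots> < \<delta>" using h N by (simp add: field_simps)
    finally have "vnorm (y + (t + h) \<cdot>\<^sub>v v - ?y) < \<delta>"
      unfolding eq vnorm_smult .
    moreover have "y + (t + h) \<cdot>\<^sub>v v \<in> carrier_vec d"
      using y v by (intro carrier_vecI) simp
    ultimately have "\<bar>\<phi> (y + (t + h) \<cdot>\<^sub>v v) - \<phi> ?y - p \<bullet> (h \<cdot>\<^sub>v v)\<bar> \<le> r / ?N * vnorm (h \<cdot>\<^sub>v v)"
      using \<delta>(2)[of "y + (t + h) \<cdot>\<^sub>v v"] unfolding eq by blast
    then have "\<bar>\<phi> (y + (t + h) \<cdot>\<^sub>v v) - \<phi> ?y - h * (p \<bullet> v)\<bar> \<le> r / ?N * (\<bar>h\<bar> * vnorm v)"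
      using v p unfolding vnorm_smult by simp
    also have "\<dots> < r * \<bar>h\<bar>"
    proof -
      have "\<bar>h\<bar> * vnorm v < \<bar>h\<bar> * ?N" using h by (intro mult_strict_left_mono) auto
      then have "r / ?N * (\<bar>h\<bar> * vnorm v) < r / ?N * (\<bar>h\<bar> * ?N)"
        using N \<open>r > 0\<close> by (intro mult_strict_left_mono) auto
      then show ?thesis using N by simp
    qed
    finally have "\<bar>\<phi> (y + (t + h) \<cdot>\<^sub>v v) - \<phi> ?y - h * (p \<bullet> v)\<bar> / \<bar>h\<bar> < r"
      using h by (simp add: field_simps)
    also have "\<bar>\<phi> (y + (t + h) \<cdot>\<^sub>v v) - \<phi> ?y - h * (p \<bullet> v)\<bar> / \<bar>h\<bar>
        = \<bar>(\<phi> (y + (t + h) \<cdot>\<^sub>v v) - \<phi> ?y) / h - p \<bullet> v\<bar>"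
      using h by (simp add: abs_divide[symmetric] diff_divide_distrib)
    finally show ?thesis .
  qed
  moreover have "\<delta> / ?N > 0" using \<delta>(1) N by simp
  ultimately show "\<exists>s>0. \<forall>h. h \<noteq> 0 \<and> norm (h - 0) < s \<longrightarrow>
      norm ((\<phi> (y + (t + h) \<cdot>\<^sub>v v) - \<phi> ?y) / h - p \<bullet> v) < r"
    by (intro exI[of _ "\<delta> / ?N"]) auto
qed

lemma has_gradient_imp_DERIV_line_0:
  assumes "has_gradient d \<phi> y p" "dim_vec v = d" "dim_vec y = d"
  shows "DERIV (\<lambda>s. \<phi> (y + s \<cdot>\<^sub>v v)) 0 :> p \<bullet> v"
proof -
  have "y + 0 \<cdot>\<^sub>v v = y" using assms by (intro eq_vecI) auto
  with assms show ?thesis by (intro has_gradient_imp_DERIV_line[where d = d]) simp_all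
qed

text \<open>Both candidates give the same directional derivative; the direction \<open>p - q\<close>
  separates them. This justifies the definite description in \<open>grad\<close>.\<close>

lemma has_gradient_unique:
  assumes "has_gradient d \<phi> y p" "has_gradient d \<phi> y q" "dim_vec y = d"
  shows "p = q"
proof (rule dot_sub_self_eq_0)
  have "p \<in> carrier_vec d" "q \<in> carrier_vec d" using assms by (simp_all add: has_gradient_def)
  then show dim: "dim_vec p = dim_vec q" by auto
  have pq: "dim_vec (p - q) = d" using \<open>q \<in> carrier_vec d\<close> by simp
  have "p \<bullet> (p - q) = q \<bullet> (p - q)"
    by (rule DERIV_unique[OF has_gradient_imp_DERIV_line_0[OF assms(1) pq assms(3)]
          has_gradient_imp_DERIV_line_0[OF assms(2) pq assms(3)]])
  then show "(p - q) \<bullet> (p - q) = 0" using dim by (simp add: dot_simps)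
qed

lemma smooth_has_gradient_grad:
  assumes "smooth_fun d L \<phi>" "dim_vec y = d"
  shows "has_gradient d \<phi> y (grad d \<phi> y)"
proof -
  obtain p where p: "has_gradient d \<phi> y p"
    using assms carrier_vecI[OF assms(2)] unfolding smooth_fun_def by blast
  then have "grad d \<phi> y = p"
    unfolding grad_def by (intro the_equality) (auto intro: has_gradient_unique assms(2))
  with p show ?thesis by simp
qed

lemma smooth_dim_grad: "smooth_fun d L \<phi> \<Longrightarrow> dim_vec y = d \<Longrightarrow> dim_vec (grad d \<phi> y) = d"
  using smooth_has_gradient_grad[of d L \<phi> y] by (simp add: has_gradient_def)

section \<open>First-order inequalities for convex and smooth functions\<close>

text \<open>Dividing the increment by \<open>s\<close> and letting \<open>s\<close> tend to 0 from
  the right removes the quadratic term. Convexity and both proximal optimality conditions are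
  derived through this limit.\<close>

lemma DERIV_le_of_quadratic_upper_bound:
  fixes \<phi> :: "real \<Rightarrow> real"
  assumes "DERIV \<phi> 0 :> D"
    and "\<And>s. 0 < s \<Longrightarrow> s < 1 \<Longrightarrow> \<phi> s \<le> \<phi> 0 + s * c + s\<^sup>2 * e"
  shows "D \<le> c"
proof (rule tendsto_le)
  show "((\<lambda>h. (\<phi> h - \<phi> 0) / h) \<longlongrightarrow> D) (at_right 0)"
    using assms(1) unfolding DERIV_def by (auto intro: filterlim_mono[OF _ order_refl at_le])
  have "((\<lambda>h. c + h * e) \<longlongrightarrow> c + 0 * e) (at_right 0)"
    by (intro tendsto_intros)
  then show "((\<lambda>h. c + h * e) \<longlongrightarrow> c) (at_right 0)" by simp
  have "(\<phi> h - \<phi> 0) / h \<le> c + h * e" if "0 < h" "h < 1" for h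
    using assms(2)[OF that] that by (simp add: field_simps power2_eq_square)
  then show "\<forall>\<^sub>F h in at_right 0. (\<phi> h - \<phi> 0) / h \<le> c + h * e"
    by (auto intro!: eventually_at_rightI[of 0 1])
qed simp

lemma convex_gradient_ineq:
  assumes conv: "convex_fun d (\<lambda>x. ereal (\<phi> x))" and p: "has_gradient d \<phi> y p"
    and x: "dim_vec x = d" and y: "dim_vec y = d"
  shows "\<phi> y + p \<bullet> (x - y) \<le> \<phi> x"
proof -
  have "p \<bullet> (x - y) \<le> \<phi> x - \<phi> y"
  proof (rule DERIV_le_of_quadratic_upper_bound)
    show "DERIV (\<lambda>s. \<phi> (y + s \<cdot>\<^sub>v (x - y))) 0 :> p \<bullet> (x - y)"
      using y by (intro has_gradient_imp_DERIV_line_0[OF p]) simp_all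
    fix s :: real assume s: "0 < s" "s < 1"
    have "y + s \<cdot>\<^sub>v (x - y) = s \<cdot>\<^sub>v x + (1 - s) \<cdot>\<^sub>v y" "y + 0 \<cdot>\<^sub>v (x - y) = y"
      using x y by (auto simp: algebra_simps intro!: eq_vecI)
    moreover have "\<phi> (s \<cdot>\<^sub>v x + (1 - s) \<cdot>\<^sub>v y) \<le> s * \<phi> x + (1 - s) * \<phi> y"
      using conv s carrier_vecI[OF x] carrier_vecI[OF y] unfolding convex_fun_def by force
    ultimately show "\<phi> (y + s \<cdot>\<^sub>v (x - y)) \<le> \<phi> (y + 0 \<cdot>\<^sub>v (x - y)) + s * (\<phi> x - \<phi> y) + s\<^sup>2 * 0"
      by (simp add: algebra_simps)
  qed
  then show ?thesis by simp
qed

text \<open>Along the segment from \<open>y\<close> to \<open>x\<close>, the gap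
  \<open>?\<psi>\<close> between the function and its quadratic model has nonpositive derivative, by
  the Lipschitz bound on the gradient.\<close>

lemma smooth_descent:
  assumes sm: "smooth_fun d L \<phi>" and x: "dim_vec x = d" and y: "dim_vec y = d"
  shows "\<phi> x \<le> \<phi> y + grad d \<phi> y \<bullet> (x - y) + L / 2 * ((x - y) \<bullet> (x - y))"
proof -
  let ?v = "x - y" and ?G = "grad d \<phi> y"
  let ?\<psi> = "\<lambda>s. \<phi> (y + s \<cdot>\<^sub>v ?v) - s * (?G \<bullet> ?v) - L / 2 * s\<^sup>2 * (?v \<bullet> ?v)"
  have v: "dim_vec ?v = d" using y by simp
  have "?\<psi> 1 \<le> ?\<psi> 0"
  proof (rule DERIV_nonpos_imp_nonincreasing[of 0 1 ?\<psi>])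
    fix s :: real assume s: "0 \<le> s" "s \<le> 1"
    let ?ys = "y + s \<cdot>\<^sub>v ?v"
    have ys: "dim_vec ?ys = d" using y by simp
    have "DERIV (\<lambda>s. \<phi> (y + s \<cdot>\<^sub>v ?v)) s :> grad d \<phi> ?ys \<bullet> ?v"
      by (rule has_gradient_imp_DERIV_line[OF smooth_has_gradient_grad[OF sm ys] v y])
    then have D: "DERIV ?\<psi> s :> grad d \<phi> ?ys \<bullet> ?v - ?G \<bullet> ?v - L * s * (?v \<bullet> ?v)"
      by (auto intro!: derivative_eq_intros)
    have eq: "?ys - y = s \<cdot>\<^sub>v ?v"
      using x y by (intro eq_vecI) auto
    have dg: "dim_vec (grad d \<phi> ?ys) = d" "dim_vec ?G = d"
      using smooth_dim_grad[OF sm] y ys by auto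
    have "grad d \<phi> ?ys \<bullet> ?v - ?G \<bullet> ?v = (grad d \<phi> ?ys - ?G) \<bullet> ?v"
      using dg v x y by (simp add: dot_diff_left)
    also have "\<dots> \<le> vnorm (grad d \<phi> ?ys - ?G) * vnorm ?v"
      using dot_le_vnorm[of "grad d \<phi> ?ys - ?G" ?v] dg v by simp
    also have "\<dots> \<le> (L * vnorm (?ys - y)) * vnorm ?v"
      using sm carrier_vecI[OF ys] carrier_vecI[OF y]
      unfolding smooth_fun_def by (intro mult_right_mono) auto
    also have "\<dots> = L * s * (?v \<bullet> ?v)"
      unfolding eq vnorm_smult vnorm_sq[symmetric] using s by (simp add: power2_eq_square)
    finally show "\<exists>D. DERIV ?\<psi> s :> D \<and> D \<le> 0" using D by force
  qed simp
  moreover have "y + 1 \<cdot>\<^sub>v ?v = x" "y + 0 \<cdot>\<^sub>v ?v = y"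
    using x y by (auto intro!: eq_vecI)
  ultimately show ?thesis by simp
qed

text \<open>The point \<open>?w\<close> is a step of length \<open>1 / L\<close> from
  \<open>x\<close> against the gradient difference. Convexity at \<open>y\<close> bounds the value
  at \<open>?w\<close> from below and the descent inequality from \<open>x\<close> bounds it from
  above.\<close>

lemma convex_smooth_cocoercive:
  assumes conv: "convex_fun d (\<lambda>x. ereal (\<phi> x))" and sm: "smooth_fun d L \<phi>" and L: "L > 0"
    and x: "dim_vec x = d" and y: "dim_vec y = d"
  shows "\<phi> y + grad d \<phi> y \<bullet> (x - y)
    + (grad d \<phi> x - grad d \<phi> y) \<bullet> (grad d \<phi> x - grad d \<phi> y) / (2 * L) \<le> \<phi> x"
proof -
  let ?p = "grad d \<phi> x" and ?q = "grad d \<phi> y"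
  let ?w = "x - (1 / L) \<cdot>\<^sub>v (?p - ?q)"
  have pq: "dim_vec ?p = d" "dim_vec ?q = d" using smooth_dim_grad[OF sm] x y by auto
  have w: "dim_vec ?w = d" using pq by simp
  have wx: "?w - x = (- (1 / L)) \<cdot>\<^sub>v (?p - ?q)"
    using pq x by (intro eq_vecI) auto
  have wy: "?w - y = (x - y) - (1 / L) \<cdot>\<^sub>v (?p - ?q)"
    using pq x y by (intro eq_vecI) auto
  have "\<phi> y + ?q \<bullet> (?w - y) \<le> \<phi> ?w"
    by (rule convex_gradient_ineq[OF conv smooth_has_gradient_grad[OF sm y] w y])
  also have "\<phi> ?w \<le> \<phi> x + ?p \<bullet> (?w - x) + L / 2 * ((?w - x) \<bullet> (?w - x))"
    by (rule smooth_descent[OF sm w x])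
  finally have "\<phi> y + ?q \<bullet> (x - y) - (1 / L) * (?q \<bullet> (?p - ?q))
      \<le> \<phi> x - (1 / L) * (?p \<bullet> (?p - ?q)) + L / 2 * (1 / L * (1 / L) * ((?p - ?q) \<bullet> (?p - ?q)))"
    unfolding wx wy using pq x y dot_diff_right[of ?q "x - y" "(1 / L) \<cdot>\<^sub>v (?p - ?q)"] by simp
  moreover have "?p \<bullet> (?p - ?q) = ?q \<bullet> (?p - ?q) + (?p - ?q) \<bullet> (?p - ?q)"
    using pq by (simp add: dot_diff_left)
  then have "(1 / L) * (?p \<bullet> (?p - ?q))
      = (1 / L) * (?q \<bullet> (?p - ?q)) + 2 * ((?p - ?q) \<bullet> (?p - ?q) / (2 * L))"
    using L by (simp add: field_simps)
  moreover have "L / 2 * (1 / L * (1 / L) * ((?p - ?q) \<bullet> (?p - ?q))) = (?p - ?q) \<bullet> (?p - ?q) / (2 * L)"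
    using L by (simp add: field_simps)
  ultimately show ?thesis by linarith
qed

text \<open>Strong convexity is stated for subgradients; by convexity the gradient is one of
  them.\<close>

lemma strongly_convex_gradient_ineq:
  assumes sc: "strongly_convex_fun d \<mu> (\<lambda>x. ereal (\<phi> x))" and sm: "smooth_fun d L \<phi>"
    and x: "dim_vec x = d" and y: "dim_vec y = d"
  shows "\<phi> y + grad d \<phi> y \<bullet> (x - y) + \<mu> / 2 * ((x - y) \<bullet> (x - y)) \<le> \<phi> x"
proof -
  have "convex_fun d (\<lambda>x. ereal (\<phi> x))" using sc by (simp add: strongly_convex_fun_def)
  then have "grad d \<phi> y \<in> subdiff d (\<lambda>x. ereal (\<phi> x)) y"
    using smooth_dim_grad[OF sm y] y convex_gradient_ineq[OF _ smooth_has_gradient_grad[OF sm y] _ y]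
    by (auto simp: subdiff_def domain_of_def intro: carrier_vecI)
  then show ?thesis
    using sc x y carrier_vecI[OF x] carrier_vecI[OF y]
    unfolding strongly_convex_fun_def domain_of_def vnorm_sq[symmetric] by (auto simp: add.assoc)
qed

section \<open>Proximal maps and subgradients\<close>

lemma prox_smooth_stationary:
  assumes sm: "smooth_fun d L \<phi>" and mem: "x \<in> prox d (\<lambda>w. ereal (a * \<phi> w)) v" and v: "dim_vec v = d"
  shows "dim_vec x = d" and "a \<cdot>\<^sub>v grad d \<phi> x + x = v"
proof -
  show x: "dim_vec x = d" using mem by (auto simp: prox_def)
  let ?G = "grad d \<phi> x"
  have G: "dim_vec ?G = d" by (rule smooth_dim_grad[OF sm x])
  have ineq: "- a * (?G \<bullet> u) \<le> (x - v) \<bullet> u" if u: "dim_vec u = d" for u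
  proof (rule DERIV_le_of_quadratic_upper_bound)
    show "DERIV (\<lambda>s. - a * \<phi> (x + s \<cdot>\<^sub>v u)) 0 :> - a * (?G \<bullet> u)"
      by (rule DERIV_cmult[OF has_gradient_imp_DERIV_line_0[OF smooth_has_gradient_grad[OF sm x] u x]])
    fix s :: real
    have eq: "x + s \<cdot>\<^sub>v u - v = (x - v) + s \<cdot>\<^sub>v u" "x + 0 \<cdot>\<^sub>v u = x"
      using x u v by (auto intro!: eq_vecI)
    have "x + s \<cdot>\<^sub>v u \<in> carrier_vec d" using x u by (auto intro: carrier_vecI)
    then have "a * \<phi> x + 1 / 2 * (vnorm (x - v))\<^sup>2
        \<le> a * \<phi> (x + s \<cdot>\<^sub>v u) + 1 / 2 * (vnorm (x + s \<cdot>\<^sub>v u - v))\<^sup>2"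
      using mem unfolding prox_def by auto
    then show "- a * \<phi> (x + s \<cdot>\<^sub>v u) \<le> - a * \<phi> (x + 0 \<cdot>\<^sub>v u) + s * ((x - v) \<bullet> u) + s\<^sup>2 * (u \<bullet> u / 2)"
      unfolding eq vnorm_sq using x u v dot_comm[of u "x - v"]
      by (simp add: dot_add_left dot_add_right power2_eq_square algebra_simps)
  qed
  let ?r = "a \<cdot>\<^sub>v ?G + x"
  \<comment> \<open>The first-order inequality holds in every direction; minus the residual is the
    direction that forces the residual to vanish.\<close>
  have "0 \<le> (?r - v) \<bullet> ((-1) \<cdot>\<^sub>v (?r - v))"
    using ineq[of "(-1) \<cdot>\<^sub>v (?r - v)"] G x v by (simp add: dot_add_left dot_diff_left algebra_simps)
  then have "(?r - v) \<bullet> (?r - v) = 0"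
    using dot_self_nonneg[of "?r - v"] by simp
  then show "?r = v" using G x v by (intro dot_sub_self_eq_0) simp_all
qed

text \<open>Minimality along the segment from \<open>y\<close> to \<open>ys\<close> says that
  \<open>(v - y) / b\<close> satisfies the subgradient inequality of \<open>F\<close> at
  \<open>y\<close>, tested at \<open>ys\<close>. Adding the inequality for \<open>p\<close> at
  \<open>ys\<close>, tested at \<open>y\<close>, gives the claim.\<close>

lemma prox_monotone:
  assumes conv: "convex_fun d F" and ninf: "\<And>w. w \<in> carrier_vec d \<Longrightarrow> F w \<noteq> -\<infinity>"
    and b: "b > 0" and mem: "y \<in> prox d (\<lambda>w. ereal b * F w) v" and v: "dim_vec v = d"
    and p: "p \<in> subdiff d F ys"
  shows "0 \<le> (v - y - b \<cdot>\<^sub>v p) \<bullet> (y - ys)"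
proof -
  have y: "y \<in> carrier_vec d" using mem by (simp add: prox_def)
  have ys: "ys \<in> carrier_vec d" "F ys \<noteq> \<infinity>" and pd: "dim_vec p = d"
    using p by (auto simp: subdiff_def domain_of_def)
  note dims = carrier_vecD[OF y] carrier_vecD[OF ys(1)] pd v
  have min: "ereal b * F y + ereal (1 / 2 * (vnorm (y - v))\<^sup>2)
      \<le> ereal b * F u + ereal (1 / 2 * (vnorm (u - v))\<^sup>2)" if "u \<in> carrier_vec d" for u
    using mem that by (simp add: prox_def)
  obtain r where r: "F ys = ereal r" using ys ninf[OF ys(1)] by (cases "F ys") auto
  obtain q where q: "F y = ereal q"
    using min[OF ys(1)] ninf[OF y] b r by (cases "F y") auto
  have "0 \<le> b * (r - q) + (y - v) \<bullet> (ys - y)"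
  \<comment> \<open>For the constant function 0 the limit lemma just extracts the sign of the linear
    coefficient.\<close>
  proof (rule DERIV_le_of_quadratic_upper_bound[of "\<lambda>_. 0"])
    fix s :: real assume s: "0 < s" "s < 1"
    let ?w = "s \<cdot>\<^sub>v ys + (1 - s) \<cdot>\<^sub>v y"
    have w: "?w \<in> carrier_vec d" using ys(1) y by simp
    have Fw: "F ?w \<le> ereal (s * r + (1 - s) * q)"
      using conv ys(1) y s r q unfolding convex_fun_def by force
    then obtain t where t: "F ?w = ereal t" using ninf[OF w] by (cases "F ?w") auto
    have "b * t \<le> b * (s * r + (1 - s) * q)" using Fw t b by simp
    moreover have "b * q + 1 / 2 * ((y - v) \<bullet> (y - v)) \<le> b * t + 1 / 2 * ((?w - v) \<bullet> (?w - v))"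
      using min[OF w] unfolding q t vnorm_sq by simp
    moreover have "?w - v = (y - v) + s \<cdot>\<^sub>v (ys - y)"
      using dims by (intro eq_vecI) (auto simp: algebra_simps)
    then have "(?w - v) \<bullet> (?w - v) = (y - v) \<bullet> (y - v) + 2 * s * ((y - v) \<bullet> (ys - y)) + s\<^sup>2 * ((ys - y) \<bullet> (ys - y))"
      using dims dot_comm[of "ys - y" "y - v"]
      by (simp add: dot_add_left dot_add_right power2_eq_square algebra_simps)
    ultimately show "0 \<le> 0 + s * (b * (r - q) + (y - v) \<bullet> (ys - y)) + s\<^sup>2 * ((ys - y) \<bullet> (ys - y) / 2)"
      by (simp add: algebra_simps)
  qed simp
  moreover have "r + p \<bullet> (y - ys) \<le> q"
    using p y r q unfolding subdiff_def by force
  then have "b * (r + p \<bullet> (y - ys)) \<le> b * q" using b by simp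
  moreover have "(v - y - b \<cdot>\<^sub>v p) \<bullet> (y - ys) = (y - v) \<bullet> (ys - y) - b * (p \<bullet> (y - ys))"
    using dims by (simp add: dot_simps algebra_simps)
  ultimately show ?thesis by (simp add: algebra_simps)
qed

lemma subdiff_monotone:
  assumes p: "p \<in> subdiff d F x" and q: "q \<in> subdiff d F y" and ninf: "\<And>w. w \<in> carrier_vec d \<Longrightarrow> F w \<noteq> -\<infinity>"
  shows "0 \<le> (p - q) \<bullet> (x - y)"
proof -
  have c: "x \<in> carrier_vec d" "y \<in> carrier_vec d" "F x \<noteq> \<infinity>" "F y \<noteq> \<infinity>" "p \<in> carrier_vec d" "q \<in> carrier_vec d"
    using p q by (auto simp: subdiff_def domain_of_def)
  obtain r s where rs: "F x = ereal r" "F y = ereal s"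
    using c ninf by (metis ereal_cases)
  have "r + p \<bullet> (y - x) \<le> s" "s + q \<bullet> (x - y) \<le> r"
    using p q c(1,2) rs unfolding subdiff_def by force+
  then show ?thesis using c by (simp add: dot_simps)
qed

section \<open>The convex conjugate\<close>

lemma conjugate_fun_not_MInf:
  assumes "proper_fun d h"
  shows "conjugate_fun d h w \<noteq> -\<infinity>"
proof -
  obtain u where u: "u \<in> carrier_vec d" "h u \<noteq> \<infinity>" "h u \<noteq> -\<infinity>"
    using assms by (auto simp: proper_fun_def domain_of_def)
  then obtain r where "h u = ereal r" by (cases "h u") auto
  then have "ereal (w \<bullet> u - r) \<le> conjugate_fun d h w"
    unfolding conjugate_fun_def using u(1) by (intro SUP_upper2[of u]) auto
  then show ?thesis by auto
qed

text \<open>The conjugate is a supremum of affine functions, so each one is bounded separately; the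
  case split on \<open>h u\<close> keeps the extended-real arithmetic well behaved.\<close>

lemma conjugate_fun_convex:
  assumes "proper_fun d h"
  shows "convex_fun d (conjugate_fun d h)"
  unfolding convex_fun_def
proof (intro ballI allI impI, elim conjE)
  fix x y :: rvec and t :: real
  assume xy: "x \<in> carrier_vec d" "y \<in> carrier_vec d" and t: "0 < t" "t < 1"
  let ?F = "conjugate_fun d h"
  show "?F (t \<cdot>\<^sub>v x + (1 - t) \<cdot>\<^sub>v y) \<le> ereal t * ?F x + ereal (1 - t) * ?F y"
    unfolding conjugate_fun_def[of d h "t \<cdot>\<^sub>v x + (1 - t) \<cdot>\<^sub>v y"]
  proof (rule SUP_least)
    fix u :: rvec assume u: "u \<in> carrier_vec d"
    have F: "ereal (w \<bullet> u) - h u \<le> ?F w" for w :: rvec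
      unfolding conjugate_fun_def by (rule SUP_upper[OF u])
    show "ereal ((t \<cdot>\<^sub>v x + (1 - t) \<cdot>\<^sub>v y) \<bullet> u) - h u \<le> ereal t * ?F x + ereal (1 - t) * ?F y"
    proof (cases "h u")
      case (real r)
      have "ereal ((t \<cdot>\<^sub>v x + (1 - t) \<cdot>\<^sub>v y) \<bullet> u) - h u = ereal t * (ereal (x \<bullet> u) - h u) + ereal (1 - t) * (ereal (y \<bullet> u) - h u)"
        using real xy u by (simp add: dot_add_left algebra_simps)
      also have "\<dots> \<le> ereal t * ?F x + ereal (1 - t) * ?F y"
        using t by (intro add_mono ereal_mult_left_mono F) auto
      finally show ?thesis .
    next
      case PInf
      then show ?thesis by simp
    next
      case MInf
      then show ?thesis using assms u by (auto simp: proper_fun_def)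
    qed
  qed
qed

section \<open>Monotonicity of gradients and Bregman distances\<close>

lemma convex_smooth_grad_cocoercive:
  assumes "convex_fun d (\<lambda>x. ereal (\<phi> x))" "smooth_fun d L \<phi>" "L > 0"
    and "dim_vec x = d" "dim_vec y = d"
  shows "(grad d \<phi> x - grad d \<phi> y) \<bullet> (grad d \<phi> x - grad d \<phi> y) / L
    \<le> (grad d \<phi> x - grad d \<phi> y) \<bullet> (x - y)"
proof -
  let ?p = "grad d \<phi> x" and ?q = "grad d \<phi> y"
  have pq: "dim_vec ?p = d" "dim_vec ?q = d" using smooth_dim_grad assms by auto
  define e where "e = (?p - ?q) \<bullet> (?p - ?q) / (2 * L)"
  have "\<phi> y + ?q \<bullet> (x - y) + e \<le> \<phi> x"
    "\<phi> x + ?p \<bullet> (y - x) + (?q - ?p) \<bullet> (?q - ?p) / (2 * L) \<le> \<phi> y"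
    using convex_smooth_cocoercive[OF assms(1-3)] assms(4,5) unfolding e_def by blast+
  moreover have "(?q - ?p) \<bullet> (?q - ?p) / (2 * L) = e" "?p \<bullet> (y - x) = - (?p \<bullet> (x - y))"
    "(?p - ?q) \<bullet> (x - y) = ?p \<bullet> (x - y) - ?q \<bullet> (x - y)"
    using pq assms(4,5) by (simp_all add: dot_simps e_def)
  moreover have "(?p - ?q) \<bullet> (?p - ?q) / L = 2 * e"
    using assms(3) by (simp add: e_def)
  ultimately show ?thesis by linarith
qed

lemma strongly_convex_grad_monotone:
  assumes "strongly_convex_fun d \<mu> (\<lambda>x. ereal (\<phi> x))" "smooth_fun d L \<phi>"
    and "dim_vec x = d" "dim_vec y = d"
  shows "\<mu> * ((x - y) \<bullet> (x - y)) \<le> (grad d \<phi> x - grad d \<phi> y) \<bullet> (x - y)"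
proof -
  let ?p = "grad d \<phi> x" and ?q = "grad d \<phi> y"
  have pq: "dim_vec ?p = d" "dim_vec ?q = d" using smooth_dim_grad assms by auto
  have "\<phi> y + ?q \<bullet> (x - y) + \<mu> / 2 * ((x - y) \<bullet> (x - y)) \<le> \<phi> x"
    "\<phi> x + ?p \<bullet> (y - x) + \<mu> / 2 * ((y - x) \<bullet> (y - x)) \<le> \<phi> y"
    using strongly_convex_gradient_ineq[OF assms(1,2)] assms(3,4) by blast+
  moreover have "(y - x) \<bullet> (y - x) = (x - y) \<bullet> (x - y)" "?p \<bullet> (y - x) = - (?p \<bullet> (x - y))"
    "(?p - ?q) \<bullet> (x - y) = ?p \<bullet> (x - y) - ?q \<bullet> (x - y)"
    using pq assms(3,4) by (simp_all add: dot_simps)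
  ultimately show ?thesis by simp
qed

text \<open>By the three-point identity, the two sides without the quadratic term differ by the
  Bregman distance from \<open>z\<close> to \<open>z'\<close>, which cocoercivity bounds below by
  that term.\<close>

lemma bregman_step:
  assumes "convex_fun d (\<lambda>x. ereal (\<phi> x))" "smooth_fun d L \<phi>" "L > 0"
    and "dim_vec z = d" "dim_vec z' = d" "dim_vec w = d"
  shows "bregman d \<phi> z' w
    + (grad d \<phi> z' - grad d \<phi> z) \<bullet> (grad d \<phi> z' - grad d \<phi> z) / (2 * L)
    \<le> bregman d \<phi> z w + (grad d \<phi> z' - grad d \<phi> w) \<bullet> (z' - z)"
proof -
  let ?p = "grad d \<phi> z'" and ?q = "grad d \<phi> z"
  have dg: "dim_vec ?p = d" "dim_vec ?q = d" "dim_vec (grad d \<phi> w) = d" using smooth_dim_grad assms by auto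
  have "\<phi> z' + ?p \<bullet> (z - z') + (?q - ?p) \<bullet> (?q - ?p) / (2 * L) \<le> \<phi> z"
    by (rule convex_smooth_cocoercive[OF assms(1-5)])
  moreover have "(?q - ?p) \<bullet> (?q - ?p) = (?p - ?q) \<bullet> (?p - ?q)"
    using dg by (simp add: dot_simps)
  ultimately show ?thesis
    using dg assms(4-6) by (simp add: bregman_def dot_diff_left dot_diff_right)
qed

lemma bregman_lower_bound:
  assumes "convex_fun d (\<lambda>x. ereal (\<phi> x))" "smooth_fun d L \<phi>" "L > 0"
    and "dim_vec z = d" "dim_vec w = d"
  shows "(grad d \<phi> z - grad d \<phi> w) \<bullet> (grad d \<phi> z - grad d \<phi> w) / (2 * L) \<le> bregman d \<phi> z w"
  using convex_smooth_cocoercive[OF assms] by (simp add: bregman_def)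

text \<open>This is \<open>bregman_step\<close> started at \<open>w\<close> itself, where the
  Bregman distance is 0.\<close>

lemma bregman_symmetric_bound:
  assumes "convex_fun d (\<lambda>x. ereal (\<phi> x))" "smooth_fun d L \<phi>" "L > 0"
    and "dim_vec z = d" "dim_vec w = d"
  shows "bregman d \<phi> z w + (grad d \<phi> z - grad d \<phi> w) \<bullet> (grad d \<phi> z - grad d \<phi> w) / (2 * L)
    \<le> (grad d \<phi> z - grad d \<phi> w) \<bullet> (z - w)"
proof -
  have "dim_vec (grad d \<phi> w) = d" using smooth_dim_grad assms by auto
  then have "bregman d \<phi> w w = 0"
    using assms by (simp add: bregman_def dot_simps)
  moreover have "dim_vec (grad d \<phi> z) = d" using smooth_dim_grad assms by auto
  ultimately show ?thesis
    using bregman_step[OF assms(1-3) assms(5) assms(4) assms(5)] by simp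
qed

subsection \<open>Energy estimates for the unified step\<close>

text \<open>
  For \<open>s\<^sub>1 = -1\<close> the dual argument \<open>y' + s\<^sub>1 (y' - y)\<close> is \<open>y\<close> and the primal one is \<open>2x' - x\<close>; for \<open>s\<^sub>1 = 1\<close>
  they are \<open>2y' - y\<close> and \<open>x\<close>. The sign \<open>s\<^sub>2\<close> plays the same role for the pair \<open>\<nabla>f(z)\<close>, \<open>x\<close>.
\<close>

lemma scheme_step_unified:
  assumes step: "scheme_step A dx dy f g h K a b c (x, y, z) (x', y', z')"
    and dims: "dim_vec x = dx" "dim_vec y = dy" "dim_vec z = dx"
    and K: "dim_row K = dy" "dim_col K = dx" and f: "smooth_fun dx L f" and c: "c > 0"
  defines "s\<^sub>1 \<equiv> sign1 A" and "s\<^sub>2 \<equiv> sign2 A"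
  shows "dim_vec x' = dx" "dim_vec y' = dy" "dim_vec z' = dx"
    and "x' \<in> prox dx (\<lambda>w. ereal (a * g w)) (x - a \<cdot>\<^sub>v (transpose_mat K *\<^sub>v (y' + s\<^sub>1 \<cdot>\<^sub>v (y' - y)))
           - a \<cdot>\<^sub>v (grad dx f z' + s\<^sub>2 \<cdot>\<^sub>v (grad dx f z' - grad dx f z)))"
    and "y' \<in> prox dy (\<lambda>w. ereal b * conjugate_fun dy h w) (y + b \<cdot>\<^sub>v (K *\<^sub>v (x' - s\<^sub>1 \<cdot>\<^sub>v (x' - x))))"
    and "z' - z = c \<cdot>\<^sub>v (x' - s\<^sub>2 \<cdot>\<^sub>v (x' - x) - z')"
proof -
  show x': "dim_vec x' = dx" and y': "dim_vec y' = dy"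
    using step by (cases A; auto simp: prox_def)+
  show z': "dim_vec z' = dx"
    using step dims x' by (cases A) auto
  have gr: "dim_vec (grad dx f z) = dx" "dim_vec (grad dx f z') = dx"
    using smooth_dim_grad[OF f] dims z' by auto
  \<comment> \<open>For each value of a sign the extrapolated argument collapses to the one written
    in the scheme; the same is done for \<open>x\<close> and for the gradient of
    \<open>f\<close>.\<close>
  have y1: "y' + (-1) \<cdot>\<^sub>v (y' - y) = y" "y' + 1 \<cdot>\<^sub>v (y' - y) = 2 \<cdot>\<^sub>v y' - y"
    using dims y' by (auto intro!: eq_vecI)
  have x1: "x' - (-1) \<cdot>\<^sub>v (x' - x) = 2 \<cdot>\<^sub>v x' - x" "x' - 1 \<cdot>\<^sub>v (x' - x) = x"
    using dims x' by (auto intro!: eq_vecI)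
  have f1: "grad dx f z' + (-1) \<cdot>\<^sub>v (grad dx f z' - grad dx f z) = grad dx f z"
    "grad dx f z' + 1 \<cdot>\<^sub>v (grad dx f z' - grad dx f z) = 2 \<cdot>\<^sub>v grad dx f z' - grad dx f z"
    using gr by (auto intro!: eq_vecI)
  have unified: "x' \<in> prox dx (\<lambda>w. ereal (a * g w)) (x - a \<cdot>\<^sub>v (transpose_mat K *\<^sub>v (y' + s\<^sub>1 \<cdot>\<^sub>v (y' - y)))
           - a \<cdot>\<^sub>v (grad dx f z' + s\<^sub>2 \<cdot>\<^sub>v (grad dx f z' - grad dx f z)))
    \<and> y' \<in> prox dy (\<lambda>w. ereal b * conjugate_fun dy h w) (y + b \<cdot>\<^sub>v (K *\<^sub>v (x' - s\<^sub>1 \<cdot>\<^sub>v (x' - x))))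
    \<and> z' = (1 / (1 + c)) \<cdot>\<^sub>v z + (c / (1 + c)) \<cdot>\<^sub>v (x' - s\<^sub>2 \<cdot>\<^sub>v (x' - x))"
  proof (cases A)
    case ACV_I
    show ?thesis
      using step unfolding s\<^sub>1_def s\<^sub>2_def ACV_I sign1.simps sign2.simps scheme_step.simps y1 x1 f1 by blast
  next
    case ACV_II
    show ?thesis
      using step unfolding s\<^sub>1_def s\<^sub>2_def ACV_II sign1.simps sign2.simps scheme_step.simps y1 x1 f1 by blast
  next
    case APDTR_I
    show ?thesis
      using step unfolding s\<^sub>1_def s\<^sub>2_def APDTR_I sign1.simps sign2.simps scheme_step.simps y1 x1 f1 by blast
  next
    case APDTR_II
    show ?thesis
      using step unfolding s\<^sub>1_def s\<^sub>2_def APDTR_II sign1.simps sign2.simps scheme_step.simps y1 x1 f1 by blast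
  qed
  then show "x' \<in> prox dx (\<lambda>w. ereal (a * g w)) (x - a \<cdot>\<^sub>v (transpose_mat K *\<^sub>v (y' + s\<^sub>1 \<cdot>\<^sub>v (y' - y)))
           - a \<cdot>\<^sub>v (grad dx f z' + s\<^sub>2 \<cdot>\<^sub>v (grad dx f z' - grad dx f z)))"
    and "y' \<in> prox dy (\<lambda>w. ereal b * conjugate_fun dy h w) (y + b \<cdot>\<^sub>v (K *\<^sub>v (x' - s\<^sub>1 \<cdot>\<^sub>v (x' - x))))"
    by blast+
  from unified have "z' = (1 / (1 + c)) \<cdot>\<^sub>v z + (c / (1 + c)) \<cdot>\<^sub>v (x' - s\<^sub>2 \<cdot>\<^sub>v (x' - x))"
    by blast
  then have eq: "z' $ i = ((1 / (1 + c)) \<cdot>\<^sub>v z + (c / (1 + c)) \<cdot>\<^sub>v (x' - s\<^sub>2 \<cdot>\<^sub>v (x' - x))) $ i" for i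
    by (rule arg_cong[where f = "\<lambda>v. v $ i"])
  show "z' - z = c \<cdot>\<^sub>v (x' - s\<^sub>2 \<cdot>\<^sub>v (x' - x) - z')"
  proof (rule eq_vecI)
    fix i assume "i < dim_vec (c \<cdot>\<^sub>v (x' - s\<^sub>2 \<cdot>\<^sub>v (x' - x) - z'))"
    then have i: "i < dx" using z' by simp
    have "z' $ i = (z $ i + c * (x' $ i - s\<^sub>2 * (x' $ i - x $ i))) / (1 + c)"
      using eq[of i] i dims x' by (simp add: add_divide_distrib)
    then have "(1 + c) * z' $ i = z $ i + c * (x' $ i - s\<^sub>2 * (x' $ i - x $ i))"
      using c by (simp add: field_simps)
    then show "(z' - z) $ i = (c \<cdot>\<^sub>v (x' - s\<^sub>2 \<cdot>\<^sub>v (x' - x) - z')) $ i"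
      using i dims x' z' by (simp add: algebra_simps)
  qed (use dims z' in simp)
qed

text \<open>Divide the three relations by \<open>a\<close>, \<open>b\<close>, \<open>c\<close> and
  add. The terms \<open>Y \<bullet> (K *\<^sub>v X)\<close> and \<open>U \<bullet> X\<close> cancel,
  the remaining terms with \<open>s\<close> and \<open>t\<close> form differences of couplings, and
  the squares come from polarisation. Here \<open>X - dX\<close>, \<open>Y - dY\<close>,
  \<open>U - dU\<close> are the errors before the step.\<close>

lemma energy_inequality:
  fixes X dX U dU Z G Y dY :: rvec
  assumes dims: "dim_vec X = n" "dim_vec dX = n" "dim_vec U = n" "dim_vec dU = n" "dim_vec Z = n"
      "dim_vec G = n" "dim_vec Y = m" "dim_vec dY = m"
    and K: "dim_row K = m" "dim_col K = n" and pos: "a > 0" "b > 0" "c > 0"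
    and E1: "a * (G \<bullet> X + (Y + s \<cdot>\<^sub>v dY) \<bullet> (K *\<^sub>v X) + (U + t \<cdot>\<^sub>v dU) \<bullet> X) + dX \<bullet> X = 0"
    and E2: "0 \<le> b * (Y \<bullet> (K *\<^sub>v (X - s \<cdot>\<^sub>v dX))) - dY \<bullet> Y"
    and E3: "D' + e \<le> D + c * (U \<bullet> (X - t \<cdot>\<^sub>v dX - Z))"
  shows "(X \<bullet> X / (2 * a) + Y \<bullet> Y / (2 * b) + D' / c + s * (Y \<bullet> (K *\<^sub>v X)) + t * (U \<bullet> X))
      + (dX \<bullet> dX / (2 * a) + dY \<bullet> dY / (2 * b) + e / c + s * (dY \<bullet> (K *\<^sub>v dX)) + t * (dU \<bullet> dX))
      + G \<bullet> X + U \<bullet> Z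
    \<le> (X - dX) \<bullet> (X - dX) / (2 * a) + (Y - dY) \<bullet> (Y - dY) / (2 * b) + D / c
      + s * ((Y - dY) \<bullet> (K *\<^sub>v (X - dX))) + t * ((U - dU) \<bullet> (X - dX))"
proof -
  have "G \<bullet> X + Y \<bullet> (K *\<^sub>v X) + s * (dY \<bullet> (K *\<^sub>v X)) + U \<bullet> X + t * (dU \<bullet> X) + dX \<bullet> X / a = 0"
    using E1 pos dims K by (simp add: dot_add_left field_simps)
  moreover have "dY \<bullet> Y / b \<le> Y \<bullet> (K *\<^sub>v X) - s * (Y \<bullet> (K *\<^sub>v dX))"
    using E2 pos dims K by (simp add: mat_vec_diff mat_vec_smult dot_diff_right field_simps)
  moreover have "D' / c + e / c \<le> D / c + U \<bullet> X - t * (U \<bullet> dX) - U \<bullet> Z"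
    using divide_right_mono[OF E3, of c] pos dims
    by (simp add: dot_diff_right add_divide_distrib diff_divide_distrib right_diff_distrib)
  moreover have "(X - dX) \<bullet> (X - dX) / (2 * a) = X \<bullet> X / (2 * a) - dX \<bullet> X / a + dX \<bullet> dX / (2 * a)"
    using dims pos dot_comm[of X dX] by (simp add: dot_diff_left dot_diff_right field_simps)
  moreover have "(Y - dY) \<bullet> (Y - dY) / (2 * b) = Y \<bullet> Y / (2 * b) - dY \<bullet> Y / b + dY \<bullet> dY / (2 * b)"
    using dims pos dot_comm[of Y dY] by (simp add: dot_diff_left dot_diff_right field_simps)
  moreover have "s * ((Y - dY) \<bullet> (K *\<^sub>v (X - dX)))
      = s * (Y \<bullet> (K *\<^sub>v X)) - s * (dY \<bullet> (K *\<^sub>v X)) - s * (Y \<bullet> (K *\<^sub>v dX)) + s * (dY \<bullet> (K *\<^sub>v dX))"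
    using dims K by (simp add: mat_vec_diff dot_diff_left dot_diff_right algebra_simps)
  moreover have "t * ((U - dU) \<bullet> (X - dX)) = t * (U \<bullet> X) - t * (dU \<bullet> X) - t * (U \<bullet> dX) + t * (dU \<bullet> dX)"
    using dims by (simp add: dot_diff_left dot_diff_right algebra_simps)
  ultimately show ?thesis by linarith
qed

text \<open>Young's inequality with weights \<open>4 * (op_norm K)\<^sup>2 * a\<close> and
  \<open>4 * a\<close> charges each coupling with \<open>X \<bullet> X / (8 * a)\<close>. For the
  chosen stepsizes the couplings then consume at most half of the diagonal terms, both in the
  Lyapunov function and among the increments.\<close>

lemma coupling_bounds:
  fixes X U Y :: rvec
  assumes "dim_vec X = dim_col K" "dim_vec U = dim_col K" "dim_vec Y = dim_row K"
    and a: "a > 0" and "op_norm K > 0" and "\<bar>s\<bar> = 1" "\<bar>t\<bar> = 1"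
  shows "\<bar>s * (Y \<bullet> (K *\<^sub>v X)) + t * (U \<bullet> X)\<bar>
    \<le> X \<bullet> X / (4 * a) + 2 * (op_norm K)\<^sup>2 * a * (Y \<bullet> Y) + 2 * a * (U \<bullet> U)"
proof -
  have k: "(op_norm K)\<^sup>2 > 0" using assms by simp
  have "\<bar>Y \<bullet> (K *\<^sub>v X)\<bar> \<le> 4 * (op_norm K)\<^sup>2 * a / 2 * (Y \<bullet> Y)
      + 1 / (2 * (4 * (op_norm K)\<^sup>2 * a)) * ((K *\<^sub>v X) \<bullet> (K *\<^sub>v X))"
    using assms k by (intro dot_Young) auto
  moreover have "1 / (2 * (4 * (op_norm K)\<^sup>2 * a)) * ((K *\<^sub>v X) \<bullet> (K *\<^sub>v X))
      \<le> 1 / (2 * (4 * (op_norm K)\<^sup>2 * a)) * ((op_norm K)\<^sup>2 * (X \<bullet> X))"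
    using assms k by (intro mult_left_mono op_norm_bound_sq) auto
  moreover have "\<dots> = X \<bullet> X / (8 * a)" using k a by (simp add: field_simps)
  moreover have "\<bar>U \<bullet> X\<bar> \<le> 4 * a / 2 * (U \<bullet> U) + 1 / (2 * (4 * a)) * (X \<bullet> X)"
    using assms by (intro dot_Young) auto
  moreover have "\<bar>s * (Y \<bullet> (K *\<^sub>v X)) + t * (U \<bullet> X)\<bar> \<le> \<bar>Y \<bullet> (K *\<^sub>v X)\<bar> + \<bar>U \<bullet> X\<bar>"
    using assms by (metis abs_mult abs_triangle_ineq mult_1)
  moreover have "X \<bullet> X / (4 * a) = X \<bullet> X / (8 * a) + 1 / (2 * (4 * a)) * (X \<bullet> X)"
    using a by (simp add: field_simps)
  moreover have "4 * (op_norm K)\<^sup>2 * a / 2 * (Y \<bullet> Y) = 2 * (op_norm K)\<^sup>2 * a * (Y \<bullet> Y)"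
    "4 * a / 2 * (U \<bullet> U) = 2 * a * (U \<bullet> U)" by simp_all
  ultimately show ?thesis by linarith
qed

text \<open>The tested equation says that the transpose applied to \<open>Y\<close> is minus the
  five-term sum \<open>?S\<close>. Testing with each of these two vectors shows that their norms
  agree.\<close>

lemma stationarity_norm_bound:
  fixes G U dU dX Y dY :: rvec
  assumes dims: "dim_vec G = n" "dim_vec U = n" "dim_vec dU = n" "dim_vec dX = n"
      "dim_vec Y = m" "dim_vec dY = m"
    and K: "dim_row K = m" "dim_col K = n" and a: "a > 0" and st: "\<bar>s\<bar> = 1" "\<bar>t\<bar> = 1"
    and E: "\<And>u. dim_vec u = n \<Longrightarrow>
      a * (G \<bullet> u + (Y + s \<cdot>\<^sub>v dY) \<bullet> (K *\<^sub>v u) + (U + t \<cdot>\<^sub>v dU) \<bullet> u) + dX \<bullet> u = 0"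
  shows "(transpose_mat K *\<^sub>v Y) \<bullet> (transpose_mat K *\<^sub>v Y)
    \<le> 5 * (G \<bullet> G + U \<bullet> U + (op_norm K)\<^sup>2 * (dY \<bullet> dY) + dU \<bullet> dU + dX \<bullet> dX / a\<^sup>2)"
proof -
  let ?w = "transpose_mat K *\<^sub>v Y" and ?v = "transpose_mat K *\<^sub>v dY"
  let ?S = "G + U + s \<cdot>\<^sub>v ?v + t \<cdot>\<^sub>v dU + (1 / a) \<cdot>\<^sub>v dX"
  have wS: "?w \<bullet> u = - (?S \<bullet> u)" if "dim_vec u = n" for u
  proof -
    have "a * (?w \<bullet> u + ?S \<bullet> u) = 0"
      using E[OF that] dims K that a
      by (simp add: dot_add_left dot_transpose algebra_simps)
    then show ?thesis using a by simp
  qed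
  have "?w \<bullet> ?w = - (?S \<bullet> ?w)" by (rule wS) (simp add: K)
  also have "?S \<bullet> ?w = ?w \<bullet> ?S" using dims K by (intro dot_comm) simp
  also have "?w \<bullet> ?S = - (?S \<bullet> ?S)" by (rule wS) (simp add: dims)
  finally have "?w \<bullet> ?w = ?S \<bullet> ?S" by simp
  also have "\<dots> \<le> 5 * (G \<bullet> G + U \<bullet> U + (s \<cdot>\<^sub>v ?v) \<bullet> (s \<cdot>\<^sub>v ?v) + (t \<cdot>\<^sub>v dU) \<bullet> (t \<cdot>\<^sub>v dU)
      + ((1 / a) \<cdot>\<^sub>v dX) \<bullet> ((1 / a) \<cdot>\<^sub>v dX))"
    using dims K by (intro dot_sum5[of _ n]) auto
  also have "(s \<cdot>\<^sub>v ?v) \<bullet> (s \<cdot>\<^sub>v ?v) = ?v \<bullet> ?v"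
    using st by (auto simp: abs_if split: if_splits)
  also have "(t \<cdot>\<^sub>v dU) \<bullet> (t \<cdot>\<^sub>v dU) = dU \<bullet> dU"
    using st by (auto simp: abs_if split: if_splits)
  also have "((1 / a) \<cdot>\<^sub>v dX) \<bullet> ((1 / a) \<cdot>\<^sub>v dX) = dX \<bullet> dX / a\<^sup>2"
    by (simp add: power2_eq_square)
  finally show ?thesis
    using op_norm_transpose_bound_sq[of dY K] dims K by simp
qed

text \<open>Scalar bookkeeping: the variables stand for squared norms, and \<open>D\<close> for the
  Bregman distance. The dual term is replaced by five dissipated quantities, each with weight
  \<open>\<sigma>\<close>; the third condition on \<open>\<theta>\<close> gives
  \<open>\<sigma> \<le> a / 4\<close>, which pays for all three increments, and the last two pay for
  \<open>g\<close> and \<open>u\<close>.\<close>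

lemma dissipation_dominates:
  fixes \<theta> a \<mu> :: real
  assumes pos: "a > 0" "lam > 0" "\<theta> \<ge> 0" "Lf > 0" "Lg > 0"
    and nonneg: "x \<ge> 0" "D \<ge> 0" "g \<ge> 0" "u \<ge> 0" "dx \<ge> 0" "dy \<ge> 0" "du \<ge> 0"
    and y: "lam * y \<le> 5 * (g + u + \<kappa>\<^sup>2 * dy + du + dx / a\<^sup>2)"
    and th: "\<theta> * (3 / (4 * a)) \<le> \<mu> / 2" "\<theta> * (12 * a * Lf) \<le> 1"
      "30 * \<kappa>\<^sup>2 * \<theta> / lam \<le> 1 / 4"
      "30 * \<kappa>\<^sup>2 * a * \<theta> / lam \<le> 1 / (2 * Lg)" "30 * \<kappa>\<^sup>2 * a * \<theta> / lam \<le> 1 / (2 * Lf)"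
  shows "\<theta> * (3 / (4 * a) * x + 6 * \<kappa>\<^sup>2 * a * y + 12 * a * Lf * D)
    \<le> dx / (4 * a) + 2 * \<kappa>\<^sup>2 * a * dy + 2 * a * du + (\<mu> / 2 * x + g / (2 * Lg)) + (D + u / (2 * Lf))"
proof -
  define \<sigma> where "\<sigma> = 30 * \<kappa>\<^sup>2 * a * \<theta> / lam"
  have \<sigma>: "\<sigma> \<ge> 0" using pos by (simp add: \<sigma>_def)
  have \<sigma>a: "\<sigma> \<le> a / 4"
    using mult_right_mono[OF th(3), of a] pos by (simp add: \<sigma>_def field_simps)
  have "\<theta> * (6 * \<kappa>\<^sup>2 * a * y) = (6 * \<kappa>\<^sup>2 * a * \<theta> / lam) * (lam * y)"
    using pos by simp
  also have "\<dots> \<le> (6 * \<kappa>\<^sup>2 * a * \<theta> / lam) * (5 * (g + u + \<kappa>\<^sup>2 * dy + du + dx / a\<^sup>2))"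
    using pos by (intro mult_left_mono y) simp
  also have "\<dots> = \<sigma> * g + \<sigma> * u + \<sigma> * (\<kappa>\<^sup>2 * dy) + \<sigma> * du + \<sigma> * (dx / a\<^sup>2)"
    by (simp add: \<sigma>_def algebra_simps add_divide_distrib)
  also have "\<dots> \<le> 1 / (2 * Lg) * g + 1 / (2 * Lf) * u + (2 * a) * (\<kappa>\<^sup>2 * dy) + (2 * a) * du + (a / 4) * (dx / a\<^sup>2)"
    using th(4,5) \<sigma>a nonneg pos unfolding \<sigma>_def[symmetric]
    by (intro add_mono mult_right_mono) auto
  also have "(a / 4) * (dx / a\<^sup>2) = dx / (4 * a)"
    using pos by (simp add: power2_eq_square)
  finally have "\<theta> * (6 * \<kappa>\<^sup>2 * a * y) \<le> g / (2 * Lg) + u / (2 * Lf) + 2 * \<kappa>\<^sup>2 * a * dy + 2 * a * du + dx / (4 * a)"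
    by (simp add: algebra_simps)
  moreover have "\<theta> * (3 / (4 * a) * x) \<le> \<mu> / 2 * x"
    using mult_right_mono[OF th(1) nonneg(1)] by (simp add: algebra_simps)
  moreover have "\<theta> * (12 * a * Lf * D) \<le> D"
    using mult_right_mono[OF th(2) nonneg(2)] by (simp add: algebra_simps)
  ultimately show ?thesis by (simp add: algebra_simps)
qed

section \<open>The composite problem: uniqueness and contraction\<close>

locale composite_saddle =
  fixes dx dy :: nat and f g :: "rvec \<Rightarrow> real" and h :: "rvec \<Rightarrow> ereal" and K :: rmat
    and Lf Lg \<mu> :: real and xs ys zs :: rvec
  assumes dy: "dy \<ge> 1"
    and Lf: "Lf > 0" and f_convex: "convex_fun dx (\<lambda>x. ereal (f x))" and f_smooth: "smooth_fun dx Lf f"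
    and \<mu>: "\<mu> > 0" and Lg: "Lg \<ge> \<mu>" and g_smooth: "smooth_fun dx Lg g"
    and g_strong: "strongly_convex_fun dx \<mu> (\<lambda>x. ereal (g x))"
    and h_proper: "proper_fun dy h"
    and K: "K \<in> carrier_mat dy dx" and lam_pos: "lambda_min (K * transpose_mat K) > 0"
    and opt: "optimal_triple dx dy f g h K xs ys zs"
begin

abbreviation "\<kappa> \<equiv> op_norm K"
abbreviation "lam \<equiv> lambda_min (K * transpose_mat K)"

lemma K_dims [simp]: "dim_row K = dy" "dim_col K = dx"
  using K by auto

lemma Lg_pos: "Lg > 0"
  using Lg \<mu> by simp

lemma g_convex: "convex_fun dx (\<lambda>x. ereal (g x))"
  using g_strong by (simp add: strongly_convex_fun_def)

lemma lam_le: "lam \<le> \<kappa>\<^sup>2"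
  by (rule lambda_min_gram_le_op_norm_sq[OF K dy])

lemma \<kappa>_pos: "\<kappa> > 0"
  using lam_le lam_pos op_norm_nonneg[of K] by (cases "\<kappa> = 0") auto

text \<open>The inclusion becomes membership of \<open>K *\<^sub>v x\<close> in the subdifferential,
  and stationarity is tested against \<open>u\<close> so that the adjoint moves onto
  \<open>u\<close>.\<close>

lemma optimal_tripleD:
  assumes "optimal_triple dx dy f g h K x y z"
  shows "dim_vec x = dx" "dim_vec y = dy" "z = x" "K *\<^sub>v x \<in> subdiff dy (conjugate_fun dy h) y"
    and "\<And>u. dim_vec u = dx \<Longrightarrow> grad dx g x \<bullet> u + y \<bullet> (K *\<^sub>v u) + grad dx f x \<bullet> u = 0"
proof -
  show x: "dim_vec x = dx" and y: "dim_vec y = dy" and z: "z = x"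
    using assms by (auto simp: optimal_triple_def)
  obtain p where p: "p \<in> subdiff dy (conjugate_fun dy h) y" "0\<^sub>v dy = p - K *\<^sub>v x"
    using assms by (auto simp: optimal_triple_def)
  have "p = K *\<^sub>v x"
    by (rule dot_sub_self_eq_0) (use p in \<open>auto simp: subdiff_def simp flip: p(2)\<close>)
  with p(1) show "K *\<^sub>v x \<in> subdiff dy (conjugate_fun dy h) y" by simp
  fix u :: rvec assume u: "dim_vec u = dx"
  have "0 = 0\<^sub>v dx \<bullet> u" by (simp only: scalar_prod_left_zero[OF carrier_vecI[OF u]])
  also have "0\<^sub>v dx = grad dx g x + transpose_mat K *\<^sub>v y + grad dx f x"
    using assms z by (simp add: optimal_triple_def)
  also have "\<dots> \<bullet> u = grad dx g x \<bullet> u + y \<bullet> (K *\<^sub>v u) + grad dx f x \<bullet> u"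
    using u x y smooth_dim_grad[OF f_smooth x] smooth_dim_grad[OF g_smooth x]
    by (simp add: dot_add_left dot_transpose)
  finally show "grad dx g x \<bullet> u + y \<bullet> (K *\<^sub>v u) + grad dx f x \<bullet> u = 0" by simp
qed

lemmas opt_dims [simp] = optimal_tripleD(1-3)[OF opt]

text \<open>The difference of the two stationarity equations, tested with \<open>x - xs\<close>, is
  a sum of three nonnegative terms equal to 0, and strong convexity of \<open>g\<close> gives
  \<open>x = xs\<close>. The dual parts then agree because \<open>lam > 0\<close>.\<close>

lemma optimal_triple_unique:
  assumes "optimal_triple dx dy f g h K x y z"
  shows "x = xs" "y = ys" "z = zs"
proof -
  note o = optimal_tripleD[OF assms]
  let ?G = "grad dx g x - grad dx g xs" and ?F = "grad dx f x - grad dx f xs"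
  have gr: "dim_vec (grad dx g x) = dx" "dim_vec (grad dx g xs) = dx"
    "dim_vec (grad dx f x) = dx" "dim_vec (grad dx f xs) = dx"
    using smooth_dim_grad[OF f_smooth] smooth_dim_grad[OF g_smooth] o(1) by auto
  have eq: "?G \<bullet> u + (y - ys) \<bullet> (K *\<^sub>v u) + ?F \<bullet> u = 0" if "dim_vec u = dx" for u
    using o(5)[OF that] optimal_tripleD(5)[OF opt that] gr o(1,2) that
    by (simp add: dot_diff_left)
  have "0 \<le> (K *\<^sub>v x - K *\<^sub>v xs) \<bullet> (y - ys)"
    by (rule subdiff_monotone[OF o(4) optimal_tripleD(4)[OF opt] conjugate_fun_not_MInf[OF h_proper]])
  also have "K *\<^sub>v x - K *\<^sub>v xs = K *\<^sub>v (x - xs)"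
    using o(1) by (simp add: mat_vec_diff)
  also have "\<dots> \<bullet> (y - ys) = (y - ys) \<bullet> (K *\<^sub>v (x - xs))"
    by (rule dot_comm) simp
  finally have "0 \<le> (y - ys) \<bullet> (K *\<^sub>v (x - xs))" .
  moreover have "0 \<le> ?F \<bullet> (x - xs)"
    using convex_smooth_grad_cocoercive[OF f_convex f_smooth Lf o(1) opt_dims(1)]
      dot_self_nonneg[of ?F] Lf by (meson divide_nonneg_pos order_trans)
  moreover have "\<mu> * ((x - xs) \<bullet> (x - xs)) \<le> ?G \<bullet> (x - xs)"
    by (rule strongly_convex_grad_monotone[OF g_strong g_smooth o(1) opt_dims(1)])
  ultimately have "\<mu> * ((x - xs) \<bullet> (x - xs)) \<le> 0"
    using eq[of "x - xs"] by simp
  then have "(x - xs) \<bullet> (x - xs) = 0"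
    using \<mu> dot_self_nonneg[of "x - xs"] by (simp add: mult_le_0_iff)
  then show x: "x = xs" using o(1) by (intro dot_sub_self_eq_0) simp_all
  then show "z = zs" using o(3) by simp
  \<comment> \<open>With \<open>x = xs\<close> both gradient differences vanish, so only the dual
    term of the tested identity survives.\<close>
  have "(transpose_mat K *\<^sub>v (y - ys)) \<bullet> (transpose_mat K *\<^sub>v (y - ys)) = 0"
    using eq[of "transpose_mat K *\<^sub>v (y - ys)"] gr o(2) unfolding x
    by (simp add: dot_transpose dot_diff_left)
  then have "lam * ((y - ys) \<bullet> (y - ys)) \<le> 0"
    using lambda_min_gram[OF K dy, of "y - ys"] by simp
  then have "(y - ys) \<bullet> (y - ys) = 0"
    using lam_pos dot_self_nonneg[of "y - ys"] by (simp add: mult_le_0_iff)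
  then show "y = ys" using o(2) by (intro dot_sub_self_eq_0) simp_all
qed

lemma lyapunov_expand:
  "lyapunov A dx f K a b c xs ys zs x y z =
    (x - xs) \<bullet> (x - xs) / (2 * a) + (y - ys) \<bullet> (y - ys) / (2 * b) + bregman dx f z xs / c
    + sign1 A * ((y - ys) \<bullet> (K *\<^sub>v (x - xs)))
    + sign2 A * ((grad dx f z - grad dx f xs) \<bullet> (x - xs))"
  by (simp add: lyapunov_def vnorm_sq)

lemma abs_sign [simp]: "\<bar>sign1 A\<bar> = 1" "\<bar>sign2 A\<bar> = 1"
  by (cases A; simp)+

text \<open>The couplings amount to at most half of the diagonal part
  \<open>2 e\<^sub>1 + 4 e\<^sub>2 + 8 e\<^sub>3\<close>, so the function lies between one half and
  three halves of that part.\<close>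

lemma lyapunov_bounds:
  fixes A :: scheme and a :: real
  assumes a: "a > 0" and dims: "dim_vec x = dx" "dim_vec y = dy" "dim_vec z = dx"
  defines "V \<equiv> lyapunov A dx f K a (1 / (8 * \<kappa>\<^sup>2 * a)) (1 / (8 * Lf * a)) xs ys zs x y z"
  shows "0 \<le> V"
    and "V \<le> 3 / (4 * a) * ((x - xs) \<bullet> (x - xs)) + 6 * \<kappa>\<^sup>2 * a * ((y - ys) \<bullet> (y - ys))
      + 12 * a * Lf * bregman dx f z xs"
proof -
  let ?X = "x - xs" and ?Y = "y - ys" and ?U = "grad dx f z - grad dx f xs" and ?D = "bregman dx f z xs"
  let ?c = "sign1 A * (?Y \<bullet> (K *\<^sub>v ?X)) + sign2 A * (?U \<bullet> ?X)"
  have "?U \<bullet> ?U / (2 * Lf) \<le> ?D"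
    by (rule bregman_lower_bound[OF f_convex f_smooth Lf dims(3)]) simp
  then have U: "?U \<bullet> ?U \<le> 2 * Lf * ?D" using Lf by (simp add: field_simps)
  then have D: "?D \<ge> 0" using dot_self_nonneg[of ?U] Lf
    by (smt (verit) mult_pos_neg)
  define e\<^sub>1 where "e\<^sub>1 = ?X \<bullet> ?X / (4 * a)"
  define e\<^sub>2 where "e\<^sub>2 = \<kappa>\<^sup>2 * a * (?Y \<bullet> ?Y)"
  define e\<^sub>3 where "e\<^sub>3 = a * Lf * ?D"
  have nonneg: "0 \<le> e\<^sub>1" "0 \<le> e\<^sub>2" "0 \<le> e\<^sub>3"
    using a Lf D dot_self_nonneg by (simp_all add: e\<^sub>1_def e\<^sub>2_def e\<^sub>3_def)
  have "\<bar>?c\<bar> \<le> ?X \<bullet> ?X / (4 * a) + 2 * \<kappa>\<^sup>2 * a * (?Y \<bullet> ?Y) + 2 * a * (?U \<bullet> ?U)"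
    using a \<kappa>_pos dims smooth_dim_grad[OF f_smooth] by (intro coupling_bounds) simp_all
  moreover have "2 * a * (?U \<bullet> ?U) \<le> 4 * e\<^sub>3"
    using mult_left_mono[OF U, of "2 * a"] a by (simp add: e\<^sub>3_def)
  ultimately have c: "\<bar>?c\<bar> \<le> e\<^sub>1 + 2 * e\<^sub>2 + 4 * e\<^sub>3"
    by (simp add: e\<^sub>1_def e\<^sub>2_def)
  have V: "V = 2 * e\<^sub>1 + 4 * e\<^sub>2 + 8 * e\<^sub>3 + ?c"
    unfolding V_def lyapunov_expand by (simp add: e\<^sub>1_def e\<^sub>2_def e\<^sub>3_def)
  show "0 \<le> V"
    using nonneg c unfolding V by linarith
  have "V \<le> 3 * e\<^sub>1 + 6 * e\<^sub>2 + 12 * e\<^sub>3"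
    using c unfolding V by linarith
  then show "V \<le> 3 / (4 * a) * (?X \<bullet> ?X) + 6 * \<kappa>\<^sup>2 * a * (?Y \<bullet> ?Y) + 12 * a * Lf * ?D"
    by (simp add: e\<^sub>1_def e\<^sub>2_def e\<^sub>3_def)
qed

text \<open>The energy inequality leaves a surplus on its left side; under the conditions on
  \<open>\<theta>\<close> this surplus is at least \<open>\<theta>\<close> times the new Lyapunov
  value.\<close>

lemma lyapunov_contraction:
  fixes A :: scheme and a \<theta> :: real
  assumes step: "scheme_step A dx dy f g h K a (1 / (8 * \<kappa>\<^sup>2 * a)) (1 / (8 * Lf * a)) (x, y, z) (x', y', z')"
    and dims: "dim_vec x = dx" "dim_vec y = dy" "dim_vec z = dx"
    and a: "a > 0" and \<theta>: "\<theta> \<ge> 0"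
    and th: "\<theta> * (3 / (4 * a)) \<le> \<mu> / 2" "\<theta> * (12 * a * Lf) \<le> 1"
      "30 * \<kappa>\<^sup>2 * \<theta> / lam \<le> 1 / 4"
      "30 * \<kappa>\<^sup>2 * a * \<theta> / lam \<le> 1 / (2 * Lg)" "30 * \<kappa>\<^sup>2 * a * \<theta> / lam \<le> 1 / (2 * Lf)"
  defines "V \<equiv> lyapunov A dx f K a (1 / (8 * \<kappa>\<^sup>2 * a)) (1 / (8 * Lf * a)) xs ys zs"
  shows "(1 + \<theta>) * V x' y' z' \<le> V x y z"
proof -
  define b where "b = 1 / (8 * \<kappa>\<^sup>2 * a)"
  define c where "c = 1 / (8 * Lf * a)"
  define s where "s = sign1 A"
  define t where "t = sign2 A"
  have b: "b > 0" and c: "c > 0" using a Lf \<kappa>_pos by (simp_all add: b_def c_def)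
  note u = scheme_step_unified[OF step dims K_dims f_smooth c[unfolded c_def],
      folded b_def c_def s_def t_def]
  note dims' [simp] = u(1-3) dims
  have gr [simp]: "dim_vec (grad dx f v) = dx" "dim_vec (grad dx g v) = dx" if "dim_vec v = dx" for v
    using that smooth_dim_grad[OF f_smooth] smooth_dim_grad[OF g_smooth] by auto
  define X where "X = x' - xs"
  define dX where "dX = x' - x"
  define Y where "Y = y' - ys"
  define dY where "dY = y' - y"
  define Z where "Z = z' - xs"
  define U where "U = grad dx f z' - grad dx f xs"
  define dU where "dU = grad dx f z' - grad dx f z"
  define G where "G = grad dx g x' - grad dx g xs"
  define D where "D = bregman dx f z xs"
  define D' where "D' = bregman dx f z' xs"
  note defs = X_def dX_def Y_def dY_def Z_def U_def dU_def G_def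
  have vdims: "dim_vec X = dx" "dim_vec dX = dx" "dim_vec U = dx" "dim_vec dU = dx" "dim_vec Z = dx"
      "dim_vec G = dx" "dim_vec Y = dy" "dim_vec dY = dy"
    by (simp_all add: defs)

  \<comment> \<open>Optimality of the primal proximal step minus \<open>a\<close> times stationarity
    at the solution. It is kept for all \<open>v\<close>, since the bound on the dual error needs
    other test vectors than \<open>X\<close>.\<close>
  have E1: "a * (G \<bullet> v + (Y + s \<cdot>\<^sub>v dY) \<bullet> (K *\<^sub>v v) + (U + t \<cdot>\<^sub>v dU) \<bullet> v) + dX \<bullet> v = 0"
    if v: "dim_vec v = dx" for v
  proof -
    let ?q = "grad dx f z' + t \<cdot>\<^sub>v dU"
    have "a \<cdot>\<^sub>v grad dx g x' + x' = x - a \<cdot>\<^sub>v (transpose_mat K *\<^sub>v (y' + s \<cdot>\<^sub>v dY)) - a \<cdot>\<^sub>v ?q"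
      unfolding dY_def dU_def by (rule prox_smooth_stationary(2)[OF g_smooth u(4)]) simp
    from arg_cong[OF this, of "\<lambda>w. w \<bullet> v"]
    have "a * (grad dx g x' \<bullet> v) + x' \<bullet> v = x \<bullet> v - a * ((y' + s \<cdot>\<^sub>v dY) \<bullet> (K *\<^sub>v v)) - a * (?q \<bullet> v)"
      using v vdims by (simp add: dot_add_left dot_diff_left dot_transpose)
    moreover have "(y' + s \<cdot>\<^sub>v dY) \<bullet> (K *\<^sub>v v) = (Y + s \<cdot>\<^sub>v dY) \<bullet> (K *\<^sub>v v) + ys \<bullet> (K *\<^sub>v v)"
      "?q \<bullet> v = (U + t \<cdot>\<^sub>v dU) \<bullet> v + grad dx f xs \<bullet> v"
      "grad dx g x' \<bullet> v = G \<bullet> v + grad dx g xs \<bullet> v" "dX \<bullet> v = x' \<bullet> v - x \<bullet> v"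
      using v vdims by (simp_all add: dot_add_left dot_diff_left Y_def U_def G_def dX_def)
    moreover have "a * (grad dx g xs \<bullet> v + ys \<bullet> (K *\<^sub>v v) + grad dx f xs \<bullet> v) = 0"
      using optimal_tripleD(5)[OF opt v] by simp
    ultimately show ?thesis by (simp add: algebra_simps)
  qed

  have E2: "0 \<le> b * (Y \<bullet> (K *\<^sub>v (X - s \<cdot>\<^sub>v dX))) - dY \<bullet> Y"
  proof -
    have "0 \<le> (y + b \<cdot>\<^sub>v (K *\<^sub>v (x' - s \<cdot>\<^sub>v dX)) - y' - b \<cdot>\<^sub>v (K *\<^sub>v xs)) \<bullet> Y"
      unfolding Y_def dX_def
      by (rule prox_monotone[OF conjugate_fun_convex[OF h_proper] conjugate_fun_not_MInf[OF h_proper]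
            b u(5) _ optimal_tripleD(4)[OF opt]]) simp
    moreover have "X - s \<cdot>\<^sub>v dX = (x' - s \<cdot>\<^sub>v dX) - xs"
      by (intro eq_vecI) (simp_all add: X_def dX_def)
    then have "K *\<^sub>v (X - s \<cdot>\<^sub>v dX) = K *\<^sub>v (x' - s \<cdot>\<^sub>v dX) - K *\<^sub>v xs"
      using vdims by (simp add: mat_vec_diff)
    then have "Y \<bullet> (K *\<^sub>v (X - s \<cdot>\<^sub>v dX)) = (K *\<^sub>v (x' - s \<cdot>\<^sub>v dX)) \<bullet> Y - (K *\<^sub>v xs) \<bullet> Y"
      using vdims dot_comm[of Y "K *\<^sub>v (x' - s \<cdot>\<^sub>v dX) - K *\<^sub>v xs"] by (simp add: dot_diff_left)
    then have "b * (Y \<bullet> (K *\<^sub>v (X - s \<cdot>\<^sub>v dX))) = b * ((K *\<^sub>v (x' - s \<cdot>\<^sub>v dX)) \<bullet> Y) - b * ((K *\<^sub>v xs) \<bullet> Y)"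
      by (simp add: right_diff_distrib)
    ultimately show ?thesis
      using vdims by (simp add: dot_add_left dot_diff_left dY_def)
  qed

  have E3: "D' + dU \<bullet> dU / (2 * Lf) \<le> D + c * (U \<bullet> (X - t \<cdot>\<^sub>v dX - Z))"
  proof -
    have "x' - t \<cdot>\<^sub>v dX - z' = X - t \<cdot>\<^sub>v dX - Z"
      by (rule eq_vecI) (simp_all add: X_def dX_def Z_def)
    then have z: "z' - z = c \<cdot>\<^sub>v (X - t \<cdot>\<^sub>v dX - Z)"
      using u(6) by (simp add: dX_def)
    have "D' + dU \<bullet> dU / (2 * Lf) \<le> D + U \<bullet> (z' - z)"
      unfolding D'_def D_def dU_def U_def
      by (rule bregman_step[OF f_convex f_smooth Lf]) simp_all
    then show ?thesis using vdims by (simp add: z)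
  qed

  have "X - dX = x - xs"
    by (rule eq_vecI) (simp_all add: X_def dX_def)
  moreover have "Y - dY = y - ys"
    by (rule eq_vecI) (simp_all add: Y_def dY_def)
  moreover have "U - dU = grad dx f z - grad dx f xs"
    by (rule eq_vecI) (simp_all add: U_def dU_def)
  ultimately have old: "X - dX = x - xs" "Y - dY = y - ys" "U - dU = grad dx f z - grad dx f xs" .
  have energy: "V x' y' z'
      + (dX \<bullet> dX / (2 * a) + dY \<bullet> dY / (2 * b) + dU \<bullet> dU / (2 * Lf) / c
         + s * (dY \<bullet> (K *\<^sub>v dX)) + t * (dU \<bullet> dX)) + G \<bullet> X + U \<bullet> Z \<le> V x y z"
    using energy_inequality[OF vdims K_dims a b c E1[OF vdims(1)] E2 E3]
    unfolding old V_def lyapunov_expand b_def[symmetric] c_def[symmetric]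
    by (simp add: s_def t_def D_def D'_def X_def Y_def U_def)

  have "\<bar>s * (dY \<bullet> (K *\<^sub>v dX)) + t * (dU \<bullet> dX)\<bar>
      \<le> dX \<bullet> dX / (4 * a) + 2 * \<kappa>\<^sup>2 * a * (dY \<bullet> dY) + 2 * a * (dU \<bullet> dU)"
    using a \<kappa>_pos vdims by (intro coupling_bounds) (simp_all add: s_def t_def)
  moreover have "dX \<bullet> dX / (2 * a) = 2 * (dX \<bullet> dX / (4 * a))"
    "dY \<bullet> dY / (2 * b) = 4 * \<kappa>\<^sup>2 * a * (dY \<bullet> dY)" "dU \<bullet> dU / (2 * Lf) / c = 4 * a * (dU \<bullet> dU)"
    using Lf by (simp_all add: b_def c_def)
  ultimately have diss: "dX \<bullet> dX / (4 * a) + 2 * \<kappa>\<^sup>2 * a * (dY \<bullet> dY) + 2 * a * (dU \<bullet> dU)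
      \<le> dX \<bullet> dX / (2 * a) + dY \<bullet> dY / (2 * b) + dU \<bullet> dU / (2 * Lf) / c
         + s * (dY \<bullet> (K *\<^sub>v dX)) + t * (dU \<bullet> dX)"
    by linarith

  \<comment> \<open>One half of \<open>G \<bullet> X\<close> is spent on strong convexity, the other
    half on cocoercivity; the resulting \<open>G \<bullet> G\<close> is needed to control
    \<open>Y\<close>.\<close>
  have GX: "\<mu> / 2 * (X \<bullet> X) + G \<bullet> G / (2 * Lg) \<le> G \<bullet> X"
  proof -
    define e where "e = G \<bullet> G / (2 * Lg)"
    have "\<mu> * (X \<bullet> X) \<le> G \<bullet> X"
      unfolding X_def G_def by (rule strongly_convex_grad_monotone[OF g_strong g_smooth]) simp_all
    moreover have "G \<bullet> G / Lg \<le> G \<bullet> X"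
      unfolding X_def G_def by (rule convex_smooth_grad_cocoercive[OF g_convex g_smooth Lg_pos]) simp_all
    then have "2 * e \<le> G \<bullet> X" by (simp add: e_def)
    ultimately show ?thesis unfolding e_def[symmetric] by simp
  qed
  have UZ: "D' + U \<bullet> U / (2 * Lf) \<le> U \<bullet> Z"
    unfolding U_def Z_def D'_def by (rule bregman_symmetric_bound[OF f_convex f_smooth Lf]) simp_all
  have "U \<bullet> U / (2 * Lf) \<le> D'"
    unfolding U_def D'_def by (rule bregman_lower_bound[OF f_convex f_smooth Lf]) simp_all
  moreover have "0 \<le> U \<bullet> U / (2 * Lf)"
    using dot_self_nonneg[of U] Lf by simp
  ultimately have D': "0 \<le> D'" by linarith
  have "lam * (Y \<bullet> Y) \<le> (transpose_mat K *\<^sub>v Y) \<bullet> (transpose_mat K *\<^sub>v Y)"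
    by (rule lambda_min_gram[OF K dy vdims(7)])
  also have "\<dots> \<le> 5 * (G \<bullet> G + U \<bullet> U + \<kappa>\<^sup>2 * (dY \<bullet> dY) + dU \<bullet> dU + dX \<bullet> dX / a\<^sup>2)"
    by (rule stationarity_norm_bound[OF vdims(6,3,4,2,7,8) K_dims a _ _ E1]) (simp_all add: s_def t_def)
  finally have Yb: "lam * (Y \<bullet> Y) \<le> \<dots>" .
  have "\<theta> * V x' y' z' \<le> \<theta> * (3 / (4 * a) * (X \<bullet> X) + 6 * \<kappa>\<^sup>2 * a * (Y \<bullet> Y) + 12 * a * Lf * D')"
    unfolding V_def X_def Y_def D'_def by (intro mult_left_mono lyapunov_bounds(2) a \<theta>) simp_all
  also have "\<dots> \<le> dX \<bullet> dX / (4 * a) + 2 * \<kappa>\<^sup>2 * a * (dY \<bullet> dY) + 2 * a * (dU \<bullet> dU)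
      + (\<mu> / 2 * (X \<bullet> X) + G \<bullet> G / (2 * Lg)) + (D' + U \<bullet> U / (2 * Lf))"
    by (rule dissipation_dominates[OF a lam_pos \<theta> Lf Lg_pos dot_self_nonneg D' dot_self_nonneg
          dot_self_nonneg dot_self_nonneg dot_self_nonneg dot_self_nonneg Yb th])
  also have "\<dots> \<le> V x y z - V x' y' z'"
    using diss GX UZ energy by linarith
  finally show ?thesis by (simp add: algebra_simps)
qed

lemma generated_dims:
  assumes "generated A dx dy f g h K a b c x y z" "c > 0"
  shows "dim_vec (x k) = dx \<and> dim_vec (y k) = dy \<and> dim_vec (z k) = dx"
proof (induction k)
  case 0
  then show ?case using assms(1) by (auto simp: generated_def)
next
  case (Suc k)
  have "scheme_step A dx dy f g h K a b c (x k, y k, z k) (x (Suc k), y (Suc k), z (Suc k))"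
    using assms(1) by (simp add: generated_def)
  from scheme_step_unified(1-3)[OF this _ _ _ K_dims f_smooth assms(2)] Suc show ?case by simp
qed

section \<open>From contraction to the iteration count\<close>

text \<open>
  With \<open>q = \<kappa> / sqrt lam \<ge> 1\<close> and \<open>l = sqrt ((Lf + Lg) / \<mu>)\<close> the minimum defining the primal stepsize is
  always attained by its second argument, which equals \<open>1 / (q l \<mu>)\<close>.
\<close>

lemma linear_convergence:
  fixes A :: scheme and a \<epsilon> :: real and k :: nat
  defines "R \<equiv> sqrt ((Lf + Lg) / \<mu>) * (\<kappa> / sqrt lam) + \<kappa>\<^sup>2 / lam"
  assumes a: "a = min (1 / sqrt (Lf * \<mu>)) (sqrt (lam / \<kappa>\<^sup>2) * (1 / sqrt ((Lg + Lf) * \<mu>)))"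
    and gen: "generated A dx dy f g h K a (1 / (8 * \<kappa>\<^sup>2 * a)) (1 / (8 * Lf * a)) x y z"
    and \<epsilon>: "\<epsilon> > 0" and k: "real k \<ge> 240 * (R * ln (1 / \<epsilon>))"
  defines "V \<equiv> lyapunov A dx f K a (1 / (8 * \<kappa>\<^sup>2 * a)) (1 / (8 * Lf * a)) xs ys zs"
  shows "V (x k) (y k) (z k) \<le> \<epsilon> * V (x 0) (y 0) (z 0)"
proof -
  define q where "q = \<kappa> / sqrt lam"
  define l where "l = sqrt ((Lf + Lg) / \<mu>)"
  have q2: "q\<^sup>2 = \<kappa>\<^sup>2 / lam" using lam_pos by (simp add: q_def power_divide)
  have "1\<^sup>2 \<le> q\<^sup>2" using lam_le lam_pos by (simp add: q2)
  moreover have "q > 0" using \<kappa>_pos lam_pos by (simp add: q_def)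
  ultimately have q: "q \<ge> 1" using power2_le_imp_le[of 1 q] by simp
  have l2: "l\<^sup>2 = (Lf + Lg) / \<mu>" using \<mu> Lf Lg_pos by (simp add: l_def)
  have l: "l > 0" using \<mu> Lf Lg_pos by (simp add: l_def)
  have L: "Lf + Lg = l\<^sup>2 * \<mu>" using \<mu> by (simp add: l2)
  have R: "R = l * q + q\<^sup>2" by (simp add: R_def l_def q_def q2[symmetric])
  have R1: "R \<ge> 1" using q l one_le_power[OF q, of 2] by (simp add: R add_increasing)
  have sqL: "sqrt ((Lg + Lf) * \<mu>) = l * \<mu>"
    using l \<mu> by (intro real_sqrt_unique) (simp_all add: L add.commute power2_eq_square)
  have a_eq: "a = 1 / (q * l * \<mu>)"
  proof -
    have "sqrt (Lf * \<mu>) \<le> l * \<mu>"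
      unfolding sqL[symmetric] using Lg_pos \<mu> by (simp add: mult_right_mono)
    also have "\<dots> \<le> q * l * \<mu>" using q l \<mu> by simp
    finally have "1 / (q * l * \<mu>) \<le> 1 / sqrt (Lf * \<mu>)"
      using Lf \<mu> by (intro divide_left_mono mult_pos_pos) (use q l in simp_all)
    moreover have "sqrt (lam / \<kappa>\<^sup>2) * (1 / sqrt ((Lg + Lf) * \<mu>)) = 1 / (q * l * \<mu>)"
      unfolding sqL using \<kappa>_pos by (simp add: q_def real_sqrt_divide)
    ultimately show ?thesis using a by simp
  qed
  have a_pos: "a > 0" using q l \<mu> by (simp add: a_eq)
  \<comment> \<open>This identity makes both smoothness conditions on \<open>\<theta>\<close> cost
    no more than the first term of \<open>R\<close>.\<close>
  have aL: "q\<^sup>2 * a * (Lf + Lg) = l * q"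
    unfolding L a_eq using q l \<mu> by (simp add: field_simps power2_eq_square)
  have q2aL: "q\<^sup>2 * a * Lf \<le> R" "q\<^sup>2 * a * Lg \<le> R"
  proof -
    have "0 \<le> q\<^sup>2 * a * Lf" "0 \<le> q\<^sup>2 * a * Lg" "0 \<le> q\<^sup>2"
      using a_pos Lf Lg_pos by simp_all
    then show "q\<^sup>2 * a * Lf \<le> R" "q\<^sup>2 * a * Lg \<le> R"
      using aL unfolding R distrib_left by linarith+
  qed

  \<comment> \<open>The factor 120 is dictated by \<open>th3\<close>, which asks for
    \<open>30 * \<theta> * q\<^sup>2 \<le> 1 / 4\<close> where only \<open>q\<^sup>2 \<le> R\<close>
    is known.\<close>
  define \<theta> where "\<theta> = 1 / (120 * R)"
  have \<theta>: "\<theta> > 0" "\<theta> \<le> 1" using R1 by (simp_all add: \<theta>_def)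
  have th1: "\<theta> * (3 / (4 * a)) \<le> \<mu> / 2"
  proof -
    have "1 / a \<le> R * \<mu>" using \<mu> by (simp add: a_eq R algebra_simps)
    then show ?thesis using R1 a_pos by (simp add: \<theta>_def field_simps)
  qed
  have th2: "\<theta> * (12 * a * Lf) \<le> 1"
  proof -
    have "1 * (a * Lf) \<le> q\<^sup>2 * (a * Lf)"
      using one_le_power[OF q, of 2] a_pos Lf by (intro mult_right_mono) simp_all
    then have "a * Lf \<le> R" using q2aL(1) by (simp add: mult.assoc)
    then show ?thesis using R1 by (simp add: \<theta>_def field_simps)
  qed
  have th3: "30 * \<kappa>\<^sup>2 * \<theta> / lam \<le> 1 / 4"
  proof -
    have "q\<^sup>2 \<le> R" using l q by (simp add: R)
    then have "30 * \<theta> * q\<^sup>2 \<le> 1 / 4" using R1 by (simp add: \<theta>_def field_simps)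
    moreover have "30 * \<kappa>\<^sup>2 * \<theta> / lam = 30 * \<theta> * q\<^sup>2" by (simp add: q2)
    ultimately show ?thesis by (simp only:)
  qed
  have th45: "30 * \<kappa>\<^sup>2 * a * \<theta> / lam \<le> 1 / (2 * M)" if "M > 0" "q\<^sup>2 * a * M \<le> R" for M
  proof -
    have "30 * \<theta> * (q\<^sup>2 * a) \<le> 1 / (2 * M)" using that R1 by (simp add: \<theta>_def field_simps)
    moreover have "30 * \<kappa>\<^sup>2 * a * \<theta> / lam = 30 * \<theta> * (q\<^sup>2 * a)" by (simp add: q2)
    ultimately show ?thesis by (simp only:)
  qed
  have c: "1 / (8 * Lf * a) > 0" using a_pos Lf by simp
  note gd = generated_dims[OF gen c]
  have nonneg: "0 \<le> V (x k) (y k) (z k)" for k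
    unfolding V_def by (rule lyapunov_bounds(1)[OF a_pos]) (use gd[of k] in simp_all)
  have contr: "(1 + \<theta>) * V (x (Suc k)) (y (Suc k)) (z (Suc k)) \<le> V (x k) (y k) (z k)" for k
  proof -
    have "scheme_step A dx dy f g h K a (1 / (8 * \<kappa>\<^sup>2 * a)) (1 / (8 * Lf * a))
        (x k, y k, z k) (x (Suc k), y (Suc k), z (Suc k))"
      using gen by (simp add: generated_def)
    then show ?thesis
      unfolding V_def using gd[of k] \<theta> th1 th2 th3 th45[OF Lg_pos q2aL(2)] th45[OF Lf q2aL(1)]
      by (intro lyapunov_contraction[OF _ _ _ _ a_pos]) simp_all
  qed
  have pow: "(1 + \<theta>) ^ k * V (x k) (y k) (z k) \<le> V (x 0) (y 0) (z 0)" for k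
  proof (induction k)
    case (Suc k)
    have "(1 + \<theta>) ^ Suc k * V (x (Suc k)) (y (Suc k)) (z (Suc k)) \<le> (1 + \<theta>) ^ k * V (x k) (y k) (z k)"
      using mult_left_mono[OF contr[of k], of "(1 + \<theta>) ^ k"] \<theta> by (simp add: ac_simps)
    with Suc show ?case by linarith
  qed simp
  \<comment> \<open>Since \<open>\<theta> \<le> 1\<close>, this yields
    \<open>ln (1 + \<theta>) \<ge> \<theta> / 2\<close>; the lost factor 2 turns 120 into the final
    constant 240.\<close>
  have "ln (1 / (1 + \<theta>)) \<le> 1 / (1 + \<theta>) - 1"
    using \<theta> by (intro ln_le_minus_one) simp
  also have "\<dots> \<le> - (\<theta> / 2)" using \<theta> by (simp add: field_simps)
  finally have "\<theta> / 2 \<le> ln (1 + \<theta>)" using \<theta> by (simp add: ln_div)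
  have "ln (1 / \<epsilon>) \<le> real k * (\<theta> / 2)"
    using k R1 by (simp add: \<theta>_def field_simps)
  also have "\<dots> \<le> real k * ln (1 + \<theta>)"
    by (intro mult_left_mono \<open>\<theta> / 2 \<le> ln (1 + \<theta>)\<close>) simp
  also have "\<dots> = ln ((1 + \<theta>) ^ k)" using \<theta> by (simp add: ln_realpow)
  finally have "1 / \<epsilon> \<le> (1 + \<theta>) ^ k" using \<epsilon> \<theta> by (subst (asm) ln_le_cancel_iff) simp_all
  then have "1 / \<epsilon> * V (x k) (y k) (z k) \<le> (1 + \<theta>) ^ k * V (x k) (y k) (z k)"
    by (intro mult_right_mono nonneg)
  also have "\<dots> \<le> V (x 0) (y 0) (z 0)" by (rule pow)
  finally show ?thesis using \<epsilon> by (simp add: field_simps)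
qed

end

section \<open>Uniqueness and complexity for all four schemes\<close>

theorem corollary3:
  shows "\<exists>C::real. C > 0 \<and>
    (\<forall>(dx::nat) (dy::nat) (f :: rvec \<Rightarrow> real) (g :: rvec \<Rightarrow> real) (h :: rvec \<Rightarrow> ereal) (K :: rmat)
       (Lf::real) (Lg::real) (\<mu>g::real) (xs::rvec) (ys::rvec) (zs::rvec).
      dx \<ge> 1 \<and> dy \<ge> 1 \<and>
      Lf > 0 \<and> convex_fun dx (\<lambda>x. ereal (f x)) \<and> smooth_fun dx Lf f \<and>
      \<mu>g > 0 \<and> Lg \<ge> \<mu>g \<and> smooth_fun dx Lg g \<and> strongly_convex_fun dx \<mu>g (\<lambda>x. ereal (g x)) \<and>
      proper_fun dy h \<and> closed_fun dy h \<and> convex_fun dy h \<and>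
      K \<in> carrier_mat dy dx \<and> lambda_min (K * transpose_mat K) > 0 \<and>
      optimal_triple dx dy f g h K xs ys zs \<longrightarrow>
      (\<forall>xs' ys' zs'. optimal_triple dx dy f g h K xs' ys' zs' \<longrightarrow>
         xs' = xs \<and> ys' = ys \<and> zs' = zs) \<and>
      (\<forall>(\<eta>x::real) (\<eta>y::real) (\<eta>z::real) (A::scheme)
         (x :: nat \<Rightarrow> rvec) (y :: nat \<Rightarrow> rvec) (z :: nat \<Rightarrow> rvec) (\<epsilon>::real) (k::nat).
        \<eta>x = min (1 / sqrt (Lf * \<mu>g))
                 (sqrt (lambda_min (K * transpose_mat K) / (op_norm K)\<^sup>2)
                    * (1 / sqrt ((Lg + Lf) * \<mu>g))) \<and>
        \<eta>y = 1 / (8 * (op_norm K)\<^sup>2 * \<eta>x) \<and>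
        \<eta>z = 1 / (8 * Lf * \<eta>x) \<and>
        generated A dx dy f g h K \<eta>x \<eta>y \<eta>z x y z \<and>
        \<epsilon> > 0 \<and>
        real k \<ge> C * ((sqrt ((Lf + Lg) / \<mu>g) * (op_norm K / sqrt (lambda_min (K * transpose_mat K)))
                        + (op_norm K)\<^sup>2 / lambda_min (K * transpose_mat K)) * ln (1 / \<epsilon>)) \<longrightarrow>
        lyapunov A dx f K \<eta>x \<eta>y \<eta>z xs ys zs (x k) (y k) (z k)
          \<le> \<epsilon> * lyapunov A dx f K \<eta>x \<eta>y \<eta>z xs ys zs (x 0) (y 0) (z 0)))"
\<comment> \<open>The goals are positivity of the constant, the three equalities of uniqueness, and
  the rate.\<close>
proof (intro exI[of _ "240 :: real"] conjI allI impI, goal_cases)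
  case 1
  show ?case by simp
next
  case (2 dx dy f g h K Lf Lg \<mu>g xs ys zs xs' ys' zs')
  then interpret composite_saddle dx dy f g h K Lf Lg \<mu>g xs ys zs
    by unfold_locales blast+
  show ?case using optimal_triple_unique(1) 2 by blast
next
  case (3 dx dy f g h K Lf Lg \<mu>g xs ys zs xs' ys' zs')
  then interpret composite_saddle dx dy f g h K Lf Lg \<mu>g xs ys zs
    by unfold_locales blast+
  show ?case using optimal_triple_unique(2) 3 by blast
next
  case (4 dx dy f g h K Lf Lg \<mu>g xs ys zs xs' ys' zs')
  then interpret composite_saddle dx dy f g h K Lf Lg \<mu>g xs ys zs
    by unfold_locales blast+
  show ?case using optimal_triple_unique(3) 4 by blast
next
  case (5 dx dy f g h K Lf Lg \<mu>g xs ys zs \<eta>x \<eta>y \<eta>z A x y z \<epsilon> k)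
  then interpret composite_saddle dx dy f g h K Lf Lg \<mu>g xs ys zs
    by unfold_locales blast+
  from 5(2) have "\<eta>y = 1 / (8 * (op_norm K)\<^sup>2 * \<eta>x)" "\<eta>z = 1 / (8 * Lf * \<eta>x)" by blast+
  with 5(2) show ?case
    using linear_convergence[of \<eta>x A x y z \<epsilon> k] by blast
qed

end
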